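(* Let $d\in\mathbb{N}$ and $S=\mathbb{R}^d\setminus\{0\}$. Let $(z_k)_{k\in\mathbb{N}}$ be positive deterministic real numbers, nondecreasing in $k$, with $z_n\to\infty$, let $(X_k)_{k\in\mathbb{N}}$ be independent $\mathbb{N}_0$-valued random variables, and let $\nu_n=\sum_{k=1}^\infty X_k\delta_{z_k/z_n}$, $n\in\mathbb{N}$. Assume that $$\prod_{k=1}^\infty\big(\mathbf{P}\{X_k=0\}+\mathbf{P}\{X_k=1\}\big)>0$$ and that $\nu_n$ converges vaguely in distribution to $\eta_c$ on $(0,\infty)$ as $n\to\infty$ for some $c>0$. Let $\mathbf{V}=(V_k)_{k\in\mathbb{N}}$ be a sequence of random vectors in $S$ such that the pairs $(V_k,X_k)$, $k\in\mathbb{N}$, are independent (with possible dependence between $V_k$ and $X_k$), and such that the conditional distribution of $V_k$ given $X_k=x$ does not depend on $k$; write $V(x)$ for a random vector with this distribution, i.e. $V(x)=_d(V_k\mid X_k=x)$ for $k\in\mathbb{N}$. Suppose that for some $0<\varepsilon<r<\infty$, $\varepsilon\le\|V(x)\|\le r$ almost surely for all $x\in\mathbb{N}$. Then the processes $$\nu_n^{\mathbf{V}}=\sum_{k=1}^\infty X_k\delta_{V_kz_k/z_n}$$ converge vaguely in distribution on $S$ to $\eta_c^{V(1)}$ as $n\to\infty$.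
   Context: $\mathbb{N}=\{1,2,\dots\}$, $\mathbb{N}_0=\mathbb{N}\cup\{0\}$, $\|\cdot\|$ is the Euclidean norm, $\delta_x$ is the Dirac measure at $x$. For $c>0$, $\eta_c$ is the Poisson process on $(0,\infty)$ with intensity measure $ct^{-1}\,dt$. For a random vector $V$ in $S$ bounded away from $0$ and $\infty$, $\eta_c^V=\sum_{k=1}^\infty\delta_{V_k'Z_k}$, where $(Z_k)_{k\in\mathbb{N}}$ is an enumeration of the points of $\eta_c$ and $(V_k')_{k\in\mathbb{N}}$ are i.i.d. copies of $V$ independent of $\eta_c$. Vague convergence in distribution means convergence in distribution as random elements of the space of locally finite measures with the vague topology (generated by integration against bounded non-negative continuous functions with relatively compact support; relatively compact in $S$ means bounded and bounded away from $0$). *)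

theory Defs
  imports "HOL-Probability.Probability"
begin

text \<open>
  The carriers \<open>E\<close> of interest are \<open>{0<..} :: real set\<close> and the punctured Euclidean space
  \<open>UNIV - {0}\<close>. A measure on \<open>E\<close> has space \<open>E\<close> and the Borel sets of \<open>E\<close> as its sigma-algebra.
\<close>

abbreviation punctured_space :: "'a::euclidean_space set" where
  "punctured_space \<equiv> UNIV - {0}"

abbreviation borel_on :: "'a::euclidean_space set \<Rightarrow> 'a measure" where
  "borel_on E \<equiv> restrict_space borel E"

text \<open>For both carriers, this is relative compactness of \<open>B\<close> in \<open>E\<close>.\<close>

definition relatively_compact_in :: "'a::euclidean_space set \<Rightarrow> 'a set \<Rightarrow> bool" where
  "relatively_compact_in E B \<longleftrightarrow> B \<subseteq> E \<and> bounded B \<and> (\<exists>\<delta>>0. \<forall>x\<in>B. \<delta> \<le> norm x)"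

definition locally_finite_measures :: "'a::euclidean_space set \<Rightarrow> 'a measure set" where
  "locally_finite_measures E =
     {\<mu>. sets \<mu> = sets (borel_on E) \<and>
         (\<forall>B\<in>sets (borel_on E). relatively_compact_in E B \<longrightarrow> emeasure \<mu> B < \<infinity>)}"

text \<open>Only the values on \<open>E\<close> of a test function matter.\<close>

definition vague_test_functions :: "'a::euclidean_space set \<Rightarrow> ('a \<Rightarrow> real) set" where
  "vague_test_functions E =
     {f. continuous_on E f \<and> bounded (f ` E) \<and> (\<forall>x\<in>E. 0 \<le> f x) \<and>
         relatively_compact_in E {x\<in>E. f x \<noteq> 0}}"

definition vague_topology :: "'a::euclidean_space set \<Rightarrow> 'a measure topology" where
  "vague_topology E = topology_generated_by
     {{\<mu> \<in> locally_finite_measures E. (\<integral>x. f x \<partial>\<mu>) \<in> U} | f U.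
        f \<in> vague_test_functions E \<and> open U}"

text \<open>
  Random elements need to take values in the space only almost surely: a random sum of Dirac
  measures may fail to be locally finite on a null event.
\<close>

definition random_element :: "'w measure \<Rightarrow> 'b topology \<Rightarrow> ('w \<Rightarrow> 'b) \<Rightarrow> bool" where
  "random_element M T \<xi> \<longleftrightarrow>
     (AE \<omega> in M. \<xi> \<omega> \<in> topspace T) \<and>
     (\<forall>U. openin T U \<longrightarrow> {\<omega> \<in> space M. \<xi> \<omega> \<in> U} \<in> sets M)"

definition expectation_of :: "'w measure \<Rightarrow> 'b topology \<Rightarrow> ('b \<Rightarrow> real) \<Rightarrow> ('w \<Rightarrow> 'b) \<Rightarrow> real" where
  "expectation_of M T F \<xi> = (LINT \<omega>:{\<omega> \<in> space M. \<xi> \<omega> \<in> topspace T}|M. F (\<xi> \<omega>))"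

definition converges_in_distribution ::
  "'b topology \<Rightarrow> 'w measure \<Rightarrow> (nat \<Rightarrow> 'w \<Rightarrow> 'b) \<Rightarrow> 'v measure \<Rightarrow> ('v \<Rightarrow> 'b) \<Rightarrow> bool" where
  "converges_in_distribution T M \<xi> N \<zeta> \<longleftrightarrow>
     (\<forall>n. random_element M T (\<xi> n)) \<and> random_element N T \<zeta> \<and>
     (\<forall>F. continuous_map T euclideanreal F \<and> bounded (F ` topspace T) \<longrightarrow>
        (\<lambda>n. expectation_of M T F (\<xi> n)) \<longlonglongrightarrow> expectation_of N T F \<zeta>)"

abbreviation vaguely_converges_in_distribution ::
  "'a::euclidean_space set \<Rightarrow> 'w measure \<Rightarrow> (nat \<Rightarrow> 'w \<Rightarrow> 'a measure)
     \<Rightarrow> 'v measure \<Rightarrow> ('v \<Rightarrow> 'a measure) \<Rightarrow> bool" where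
  "vaguely_converges_in_distribution E \<equiv> converges_in_distribution (vague_topology E)"

text \<open>The measure on \<open>E\<close> that is the sum over \<open>k\<close> of \<open>w k\<close> times the Dirac measure at \<open>x k\<close>.\<close>

definition dirac_sum :: "'a::euclidean_space set \<Rightarrow> (nat \<Rightarrow> nat) \<Rightarrow> (nat \<Rightarrow> 'a) \<Rightarrow> 'a measure" where
  "dirac_sum E w x = measure_of E (sets (borel_on E))
     (\<lambda>B. \<Sum>k. of_nat (w k) * emeasure (return (borel_on E) (x k)) B)"

text \<open>
  On sets of infinite intensity the process is almost surely infinite; this follows from
  the conditions below when the intensity measure is sigma-finite.
\<close>

definition poisson_process ::
  "'v measure \<Rightarrow> 'a::euclidean_space set \<Rightarrow> 'a measure \<Rightarrow> ('v \<Rightarrow> 'a measure) \<Rightarrow> bool" where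
  "poisson_process N E \<Lambda> \<eta> \<longleftrightarrow>
     (\<forall>\<omega>\<in>space N. \<eta> \<omega> \<in> locally_finite_measures E) \<and>
     (\<forall>B\<in>sets (borel_on E). emeasure \<Lambda> B < \<infinity> \<longrightarrow>
        (\<forall>k::nat. measure N {\<omega> \<in> space N. emeasure (\<eta> \<omega>) B = of_nat k} =
           measure \<Lambda> B ^ k / fact k * exp (- measure \<Lambda> B))) \<and>
     (\<forall>(m::nat) B. (\<forall>i<m. B i \<in> sets (borel_on E)) \<and> disjoint_family_on B {..<m} \<longrightarrow>
        prob_space.indep_vars N (\<lambda>_. borel) (\<lambda>i \<omega>. emeasure (\<eta> \<omega>) (B i)) {..<m})"

definition log_intensity :: "real \<Rightarrow> real measure" where
  "log_intensity c = density (restrict_space lborel {0<..}) (\<lambda>t. ennreal (c / t))"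

text \<open>
  Independence of two random elements; unlike in \<^const>\<open>prob_space.indep_var\<close>, their value types
  may differ.
\<close>

definition independent_pair ::
  "'v measure \<Rightarrow> 'b measure \<Rightarrow> ('v \<Rightarrow> 'b) \<Rightarrow> 'c measure \<Rightarrow> ('v \<Rightarrow> 'c) \<Rightarrow> bool" where
  "independent_pair N A X B Y \<longleftrightarrow>
     X \<in> measurable N A \<and> Y \<in> measurable N B \<and>
     prob_space.indep_set N {X -` C \<inter> space N | C. C \<in> sets A} {Y -` C \<inter> space N | C. C \<in> sets B}"

end

theory Submission
  imports Defs
begin

text \<open>
The law of a random measure is governed by its Laplace functional
\<open>f \<mapsto> E exp (- \<integral> f)\<close>, and marking acts on Laplace functionals in a transparent way.
Fix a test function \<open>f\<close> on the punctured space, let \<open>L\<close> be the law of \<open>V(1)\<close>, and put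
\<open>\<phi> t = \<integral> exp (- f (t v)) L(dv)\<close> and \<open>g = - ln \<phi>\<close>. Because \<open>L\<close> lives on
\<open>\<epsilon> \<le> \<parallel>v\<parallel> \<le> r\<close>, \<open>g\<close> is again a test function, now on \<open>(0, \<infinity>)\<close>
(\<open>mark_laplace_test_function\<close>). Integrating out the marks of the limit process gives
\<open>E exp (- \<integral> f d\<eta>\<^sup>V) = E (\<Prod>k. \<phi> (Z k)) = E exp (- \<integral> g d\<eta>)\<close>
(\<open>expectation_prod_independent_marks\<close>), and the assumed convergence, applied to the continuous
functional \<open>\<mu> \<mapsto> exp (- \<integral> g d\<mu>)\<close>, sends \<open>E exp (- \<integral> g d\<nu>\<^sub>n)\<close> to this same number.

It remains to compare the Laplace functional of \<open>\<nu>\<^sub>n\<^sup>V\<close> at \<open>f\<close> with that of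
\<open>\<nu>\<^sub>n\<close> at \<open>g\<close>. By independence both are products over \<open>k\<close>, of factors \<open>a k\<close> and
\<open>b k\<close> in the unit interval, so they differ by at most the sum of \<open>\<bar>a k - b k\<bar>\<close>. On
\<open>X k = 0\<close> the two integrands agree, on \<open>X k = 1\<close> they have the same mean by the definition
of \<open>\<phi>\<close>, and hence \<open>\<bar>a k - b k\<bar> \<le> P (X k \<ge> 2)\<close> (\<open>replace_mark_error\<close>). These
probabilities are summable since the product of the \<open>1 - P (X k \<ge> 2)\<close> is positive. Moreover
\<open>a k = b k = 1\<close> when \<open>z k / z n\<close> is too small for the scaled mark to reach the support of
\<open>f\<close>, which for each fixed \<open>k\<close> happens as soon as \<open>n\<close> is large. So the difference is bounded
by tails of a convergent series.

The analytic half is the passage from Laplace functionals to convergence in distribution. The vague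
topology is induced by countably many functions \<open>\<mu> \<mapsto> exp (- \<integral> g\<^sub>j d\<mu>)\<close>
(\<open>vague_topology_countably_generated\<close>), that is, by a map \<open>\<Phi>\<close> into the cube
\<open>[0, 1]\<^sup>\<nat>\<close>. Monomials in the coordinates of \<open>\<Phi>\<close> are Laplace functionals, so their
expectations converge; by the Stone-Weierstrass theorem on the compact cube the same holds for every
continuous function of \<open>\<Phi>\<close>. A bounded continuous functional of the random measure is a monotone
limit of such functions from below, and by symmetry from above, and this is enough
(\<open>converges_in_distribution_coordinates\<close>).
\<close>

section \<open>Convergence in distribution through countably many coordinates\<close>

lemma random_element_borel_measurable:
  assumes re: "random_element M T \<xi>" and F: "continuous_map T euclideanreal F"
  shows "(\<lambda>\<omega>. indicator {\<omega> \<in> space M. \<xi> \<omega> \<in> topspace T} \<omega> *\<^sub>R F (\<xi> \<omega>)) \<in> borel_measurable M"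
proof -
  let ?A = "{\<omega> \<in> space M. \<xi> \<omega> \<in> topspace T}"
  have A: "?A \<in> sets M"
    using re unfolding random_element_def by auto
  have "(\<lambda>\<omega>. F (\<xi> \<omega>)) \<in> borel_measurable (restrict_space M ?A)"
  proof (rule borel_measurableI)
    fix S :: "real set" assume "open S"
    then have "openin T {\<mu> \<in> topspace T. F \<mu> \<in> S}"
      using F by (auto simp: continuous_map_def)
    then have "{\<omega> \<in> space M. \<xi> \<omega> \<in> {\<mu> \<in> topspace T. F \<mu> \<in> S}} \<in> sets M"
      using re unfolding random_element_def by blast
    also have "{\<omega> \<in> space M. \<xi> \<omega> \<in> {\<mu> \<in> topspace T. F \<mu> \<in> S}} =
      (\<lambda>\<omega>. F (\<xi> \<omega>)) -` S \<inter> space (restrict_space M ?A)"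
      by (auto simp: space_restrict_space)
    finally show "(\<lambda>\<omega>. F (\<xi> \<omega>)) -` S \<inter> space (restrict_space M ?A) \<in> sets (restrict_space M ?A)"
      using A by (subst sets_restrict_space_iff) (auto simp: space_restrict_space)
  qed
  then show ?thesis
    using A by (subst (asm) borel_measurable_restrict_space_iff) (auto simp: Int_absorb2)
qed

lemma random_element_integrable:
  assumes M: "prob_space M" and re: "random_element M T \<xi>"
    and F: "continuous_map T euclideanreal F" and b: "bounded (F ` topspace T)"
  shows "integrable M (\<lambda>\<omega>. indicator {\<omega> \<in> space M. \<xi> \<omega> \<in> topspace T} \<omega> *\<^sub>R F (\<xi> \<omega>))"
proof -
  interpret prob_space M by fact
  obtain B where B: "\<And>\<mu>. \<mu> \<in> topspace T \<Longrightarrow> \<bar>F \<mu>\<bar> \<le> B" "B > 0"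
    using b unfolding bounded_pos by auto
  show ?thesis
    by (rule integrable_const_bound[where B = B])
      (use B random_element_borel_measurable[OF re F] in \<open>auto simp: indicator_def less_imp_le\<close>)
qed

lemma expectation_of_add:
  assumes "prob_space M" "random_element M T \<xi>"
    and "continuous_map T euclideanreal F" "bounded (F ` topspace T)"
    and "continuous_map T euclideanreal G" "bounded (G ` topspace T)"
  shows "expectation_of M T (\<lambda>\<mu>. F \<mu> + G \<mu>) \<xi> = expectation_of M T F \<xi> + expectation_of M T G \<xi>"
  using Bochner_Integration.integral_add[OF random_element_integrable[OF assms(1-4)]
      random_element_integrable[OF assms(1,2,5,6)]]
  by (simp add: expectation_of_def set_lebesgue_integral_def algebra_simps)

lemma expectation_of_cmult:
  "expectation_of M T (\<lambda>\<mu>. a * F \<mu>) \<xi> = a * expectation_of M T F \<xi>"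
  by (simp add: expectation_of_def)

lemma expectation_of_const:
  assumes "prob_space M" "random_element M T \<xi>"
  shows "expectation_of M T (\<lambda>_. a) \<xi> = a"
proof -
  interpret prob_space M by fact
  have "(AE \<omega> in M. \<omega> \<in> {\<omega> \<in> space M. \<xi> \<omega> \<in> topspace T})"
    using assms(2) AE_space unfolding random_element_def by auto
  moreover have "{\<omega> \<in> space M. \<xi> \<omega> \<in> topspace T} \<in> sets M"
    using assms(2) unfolding random_element_def by auto
  ultimately have "prob {\<omega> \<in> space M. \<xi> \<omega> \<in> topspace T} = 1"
    using prob_eq_1 by blast
  then show ?thesis
    by (simp add: expectation_of_def set_lebesgue_integral_def Int_absorb2)
qed

lemma expectation_of_mono:
  assumes "prob_space M" "random_element M T \<xi>"
    and "continuous_map T euclideanreal F" "bounded (F ` topspace T)"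
    and "continuous_map T euclideanreal G" "bounded (G ` topspace T)"
    and "\<And>\<mu>. \<mu> \<in> topspace T \<Longrightarrow> F \<mu> \<le> G \<mu>"
  shows "expectation_of M T F \<xi> \<le> expectation_of M T G \<xi>"
  unfolding expectation_of_def set_lebesgue_integral_def
  by (intro integral_mono random_element_integrable assms)
    (auto simp: indicator_def assms)

lemma expectation_of_cong:
  "(\<And>\<mu>. \<mu> \<in> topspace T \<Longrightarrow> F \<mu> = G \<mu>) \<Longrightarrow> expectation_of M T F \<xi> = expectation_of M T G \<xi>"
  unfolding expectation_of_def set_lebesgue_integral_def
  by (intro Bochner_Integration.integral_cong) (auto simp: indicator_def)

lemma expectation_of_close:
  assumes M: "prob_space M" and re: "random_element M T \<xi>"
    and F: "continuous_map T euclideanreal F" "bounded (F ` topspace T)"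
    and G: "continuous_map T euclideanreal G" "bounded (G ` topspace T)"
    and close: "\<And>\<mu>. \<mu> \<in> topspace T \<Longrightarrow> \<bar>F \<mu> - G \<mu>\<bar> \<le> e"
  shows "\<bar>expectation_of M T F \<xi> - expectation_of M T G \<xi>\<bar> \<le> e"
proof -
  have bd: "bounded ((\<lambda>\<mu>. H \<mu> + e) ` topspace T)" if "bounded (H ` topspace T)"
    for H :: "_ \<Rightarrow> real"
    using bounded_translation[OF that, of e] by (simp add: image_image add.commute)
  have shift: "expectation_of M T (\<lambda>\<mu>. H \<mu> + e) \<xi> = expectation_of M T H \<xi> + e"
    if "continuous_map T euclideanreal H" "bounded (H ` topspace T)" for H
    by (subst expectation_of_add[OF M re that])
      (auto simp: expectation_of_const[OF M re] image_constant_conv)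
  have "expectation_of M T F \<xi> \<le> expectation_of M T (\<lambda>\<mu>. G \<mu> + e) \<xi>"
    using close by (intro expectation_of_mono[OF M re F] continuous_intros G bd)
      (fastforce simp: abs_le_iff)+
  moreover have "expectation_of M T G \<xi> \<le> expectation_of M T (\<lambda>\<mu>. F \<mu> + e) \<xi>"
    using close by (intro expectation_of_mono[OF M re G] continuous_intros F bd)
      (fastforce simp: abs_le_iff)+
  ultimately show ?thesis
    using shift[OF F] shift[OF G] by auto
qed

abbreviation unit_cube :: "(nat \<Rightarrow> real) set" where
  "unit_cube \<equiv> {x. \<forall>j. x j \<in> {0..1}}"

lemma compact_unit_cube: "compact unit_cube"
proof -
  have "compactin (product_topology (\<lambda>_. euclidean) UNIV) (PiE UNIV (\<lambda>_::nat. {0..1::real}))"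
    by (simp add: compactin_PiE)
  moreover have "PiE UNIV (\<lambda>_::nat. {0..1::real}) = unit_cube"
    by (auto simp: PiE_def Pi_def)
  ultimately show ?thesis
    by (metis compactin_euclidean_iff euclidean_product_topology)
qed

inductive_set coordinate_polynomials :: "((nat \<Rightarrow> real) \<Rightarrow> real) set" where
  monomial: "(\<lambda>x. a * prod_list (map x js)) \<in> coordinate_polynomials"
| add: "p \<in> coordinate_polynomials \<Longrightarrow> q \<in> coordinate_polynomials \<Longrightarrow>
    (\<lambda>x. p x + q x) \<in> coordinate_polynomials"

lemma coordinate_polynomials_mult:
  assumes "p \<in> coordinate_polynomials" "q \<in> coordinate_polynomials"
  shows "(\<lambda>x. p x * q x) \<in> coordinate_polynomials"
  using assms(1)
proof induction
  case (monomial a js)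
  show ?case using assms(2)
  proof induction
    case (monomial b ks)
    have "(\<lambda>x. a * prod_list (map x js) * (b * prod_list (map x ks))) =
        (\<lambda>x. (a * b) * prod_list (map x (js @ ks)))"
      by (auto simp: algebra_simps)
    then show ?case
      using coordinate_polynomials.monomial[of "a * b" "js @ ks"] by metis
  next
    case (add p q)
    then show ?case
      using coordinate_polynomials.add by (fastforce simp: distrib_left)
  qed
next
  case (add p q)
  then show ?case
    using coordinate_polynomials.add by (fastforce simp: distrib_right)
qed

lemma continuous_on_coordinate_monomial:
  "continuous_on S (\<lambda>x :: nat \<Rightarrow> real. prod_list (map x js))"
  by (induction js)
    (auto intro!: continuous_intros continuous_on_subset[OF continuous_on_product_coordinates])

lemma continuous_on_coordinate_polynomial:
  "p \<in> coordinate_polynomials \<Longrightarrow> continuous_on S p"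
  by (induction rule: coordinate_polynomials.induct)
    (auto intro!: continuous_intros continuous_on_coordinate_monomial)

text \<open>
Stone-Weierstrass on the cube, which is compact by Tychonoff's theorem; the single coordinates already
separate points.
\<close>

lemma coordinate_polynomials_dense:
  assumes h: "continuous_on unit_cube h" and e: "0 < e"
  shows "\<exists>p\<in>coordinate_polynomials. \<forall>x\<in>unit_cube. \<bar>h x - p x\<bar> < e"
proof -
  interpret function_ring_on coordinate_polynomials unit_cube
  proof
    show "(\<lambda>_. a) \<in> coordinate_polynomials" for a
      using monomial[of a "[]"] by simp
    fix x y :: "nat \<Rightarrow> real" assume "x \<noteq> y"
    then obtain j where "x j \<noteq> y j" by auto
    with monomial[of 1 "[j]"] show "\<exists>f\<in>coordinate_polynomials. f x \<noteq> f y"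
      by (intro bexI[of _ "\<lambda>x. 1 * prod_list (map x [j])"]) auto
  next
    show "compact unit_cube" by (rule compact_unit_cube)
  qed (auto intro: continuous_on_coordinate_polynomial
      coordinate_polynomials.add coordinate_polynomials_mult)
  show ?thesis using Stone_Weierstrass_basic[OF h e] .
qed

text \<open>
Only the image of \<open>\<Phi>\<close> in the cube matters, and it may fail to be closed, so a bounded continuous
functional \<open>F\<close> need not be the restriction of a continuous function on the cube. It is however the
increasing limit of the Lipschitz functions
\<open>h m x = (INF \<mu>. F \<mu> + m * dist x (\<Phi> \<mu>))\<close>, whose expectations converge. This yields
\<open>liminf E F(\<xi>\<^sub>n) \<ge> E F(\<zeta>)\<close>, and applying it to \<open>- F\<close> gives the limit.
\<close>

lemma converges_in_distribution_coordinates: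
  fixes T :: "'b topology" and \<Phi> :: "'b \<Rightarrow> nat \<Rightarrow> real"
  assumes M: "prob_space M" and N: "prob_space N"
    and cube: "\<And>\<mu>. \<mu> \<in> topspace T \<Longrightarrow> \<Phi> \<mu> \<in> unit_cube"
    and cont: "\<And>j. continuous_map T euclideanreal (\<lambda>\<mu>. \<Phi> \<mu> j)"
    and initial: "\<And>U. openin T U \<Longrightarrow> \<exists>W. open W \<and> U = {\<mu> \<in> topspace T. \<Phi> \<mu> \<in> W}"
    and re: "\<And>n. random_element M T (\<xi> n)" and re': "random_element N T \<zeta>"
    and moments: "\<And>js. (\<lambda>n. expectation_of M T (\<lambda>\<mu>. prod_list (map (\<Phi> \<mu>) js)) (\<xi> n))
       \<longlonglongrightarrow> expectation_of N T (\<lambda>\<mu>. prod_list (map (\<Phi> \<mu>) js)) \<zeta>"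
  shows "converges_in_distribution T M \<xi> N \<zeta>"
proof -
  have contPhi: "continuous_map T euclidean \<Phi>"
    using cont by (subst euclidean_product_topology[symmetric]) (auto simp: continuous_map_componentwise_UNIV)
  have cont_comp: "continuous_map T euclideanreal (\<lambda>\<mu>. h (\<Phi> \<mu>))" if "continuous_on UNIV h" for h
    using continuous_map_compose[OF contPhi, of euclideanreal h] that by (simp add: o_def)
  have bdd_comp: "bounded ((\<lambda>\<mu>. h (\<Phi> \<mu>)) ` topspace T)" if "continuous_on UNIV h"
    for h :: "_ \<Rightarrow> real"
  proof (rule bounded_subset)
    show "bounded (h ` unit_cube)"
      using that by (intro compact_imp_bounded compact_continuous_image compact_unit_cube)
        (auto intro: continuous_on_subset)
  qed (use cube in blast)
  let ?conv = "\<lambda>h. (\<lambda>n. expectation_of M T (\<lambda>\<mu>. h (\<Phi> \<mu>)) (\<xi> n))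
       \<longlonglongrightarrow> expectation_of N T (\<lambda>\<mu>. h (\<Phi> \<mu>)) \<zeta>"
  have poly: "?conv p" if "p \<in> coordinate_polynomials" for p
    using that
  proof induction
    case (monomial a js)
    show ?case
      using tendsto_mult_left[OF moments] by (simp add: expectation_of_cmult)
  next
    case (add p q)
    then have "continuous_on UNIV p" "continuous_on UNIV q"
      by (auto intro: continuous_on_coordinate_polynomial)
    then show ?case
      using tendsto_add[OF add.IH]
      by (simp add: expectation_of_add[OF M re] expectation_of_add[OF N re'] cont_comp bdd_comp)
  qed
  have cts: "?conv h" if h: "continuous_on UNIV h" for h
  proof (rule LIMSEQ_I)
    fix e :: real assume "0 < e"
    then obtain p where p: "p \<in> coordinate_polynomials"
      and close: "\<And>x. x \<in> unit_cube \<Longrightarrow> \<bar>h x - p x\<bar> < e / 3"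
      using coordinate_polynomials_dense[of h "e / 3"] h continuous_on_subset[of UNIV h unit_cube]
      by (metis (no_types, lifting) divide_pos_pos subset_UNIV zero_less_numeral)
    have cp: "continuous_on UNIV p"
      using p by (rule continuous_on_coordinate_polynomial)
    have 1: "\<bar>expectation_of M T (\<lambda>\<mu>. h (\<Phi> \<mu>)) (\<xi> n) - expectation_of M T (\<lambda>\<mu>. p (\<Phi> \<mu>)) (\<xi> n)\<bar> \<le> e / 3" for n
      using close cube by (intro expectation_of_close[OF M re] cont_comp bdd_comp h cp) (auto simp: less_imp_le)
    have 2: "\<bar>expectation_of N T (\<lambda>\<mu>. h (\<Phi> \<mu>)) \<zeta> - expectation_of N T (\<lambda>\<mu>. p (\<Phi> \<mu>)) \<zeta>\<bar> \<le> e / 3"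
      using close cube by (intro expectation_of_close[OF N re'] cont_comp bdd_comp h cp) (auto simp: less_imp_le)
    obtain n0 where n0: "\<And>n. n \<ge> n0 \<Longrightarrow> norm (expectation_of M T (\<lambda>\<mu>. p (\<Phi> \<mu>)) (\<xi> n) - expectation_of N T (\<lambda>\<mu>. p (\<Phi> \<mu>)) \<zeta>) < e / 3"
      using LIMSEQ_D[OF poly[OF p], of "e / 3"] \<open>0 < e\<close> by auto
    have "norm (expectation_of M T (\<lambda>\<mu>. h (\<Phi> \<mu>)) (\<xi> n) - expectation_of N T (\<lambda>\<mu>. h (\<Phi> \<mu>)) \<zeta>) < e"
      if "n \<ge> n0" for n
      using 1[of n] 2 n0[OF that] unfolding real_norm_def by linarith
    then show "\<exists>n0. \<forall>n\<ge>n0. norm (expectation_of M T (\<lambda>\<mu>. h (\<Phi> \<mu>)) (\<xi> n) - expectation_of N T (\<lambda>\<mu>. h (\<Phi> \<mu>)) \<zeta>) < e"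
      by blast
  qed
  have "topspace T \<noteq> {}"
    using re' prob_space.AE_False[OF N] unfolding random_element_def by auto
  have lower: "eventually (\<lambda>n. expectation_of N T F \<zeta> - e < expectation_of M T F (\<xi> n)) sequentially"
    if F: "continuous_map T euclideanreal F" and bF: "bounded (F ` topspace T)" and e: "0 < e" for F e
  proof -
    obtain B where B: "\<And>\<mu>. \<mu> \<in> topspace T \<Longrightarrow> \<bar>F \<mu>\<bar> \<le> B" "B > 0"
      using bF unfolding bounded_pos by auto
    define h where "h m x = (INF \<mu>\<in>topspace T. F \<mu> + real m * dist x (\<Phi> \<mu>))" for m :: nat and x
    have ge: "- B \<le> F \<mu> + real m * dist x (\<Phi> \<mu>)" if "\<mu> \<in> topspace T" for m x \<mu>
      using B(1)[OF that] mult_nonneg_nonneg[of "real m" "dist x (\<Phi> \<mu>)", OF of_nat_0_le_iff zero_le_dist]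
      unfolding abs_le_iff by linarith
    have bdd: "bdd_below ((\<lambda>\<mu>. F \<mu> + real m * dist x (\<Phi> \<mu>)) ` topspace T)" for m x
      using ge by (auto simp: bdd_below_def)
    have h_le: "h m x \<le> F \<mu> + real m * dist x (\<Phi> \<mu>)" if "\<mu> \<in> topspace T" for m x \<mu>
      unfolding h_def using that by (intro cINF_lower bdd)
    have h_greatest: "t \<le> h m x" if "\<And>\<mu>. \<mu> \<in> topspace T \<Longrightarrow> t \<le> F \<mu> + real m * dist x (\<Phi> \<mu>)" for t m x
      unfolding h_def using \<open>topspace T \<noteq> {}\<close> that by (intro cINF_greatest)
    have lip: "h m x \<le> h m y + real m * dist x y" for m x y
    proof -
      have "h m x - real m * dist x y \<le> h m y"
      proof (rule h_greatest)
        fix \<mu> assume "\<mu> \<in> topspace T"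
        have "h m x \<le> F \<mu> + real m * dist x (\<Phi> \<mu>)"
          by (rule h_le) fact
        also have "\<dots> \<le> F \<mu> + real m * (dist x y + dist y (\<Phi> \<mu>))"
          by (intro add_left_mono mult_left_mono dist_triangle) auto
        finally show "h m x - real m * dist x y \<le> F \<mu> + real m * dist y (\<Phi> \<mu>)"
          by (simp add: algebra_simps)
      qed
      then show ?thesis by simp
    qed
    have ch: "continuous_on UNIV (h m)" for m
    proof (rule lipschitz_on_continuous_on[of "real m"], rule lipschitz_onI)
      show "dist (h m x) (h m y) \<le> real m * dist x y" for x y
        using lip[of m x y] lip[of m y x] by (auto simp: dist_real_def abs_le_iff dist_commute)
    qed auto
    \<comment> \<open>Near \<open>\<Phi> \<nu>\<close> the infimum is controlled by continuity of \<open>F\<close>; away from it the penalty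
      \<open>m * \<rho>\<close> exceeds the oscillation \<open>2 * B\<close> of \<open>F\<close>.\<close>
    have h_lim: "(\<lambda>m. h m (\<Phi> \<nu>)) \<longlonglongrightarrow> F \<nu>" if \<nu>: "\<nu> \<in> topspace T" for \<nu>
    proof (rule LIMSEQ_I)
      fix e :: real assume e: "0 < e"
      have "openin T {\<mu> \<in> topspace T. F \<mu> \<in> {F \<nu> - e / 2<..}}"
        using F by (intro openin_continuous_map_preimage[OF F]) auto
      then obtain W where W: "open W" "{\<mu> \<in> topspace T. F \<mu> \<in> {F \<nu> - e / 2<..}} = {\<mu> \<in> topspace T. \<Phi> \<mu> \<in> W}"
        using initial by meson
      have "\<nu> \<in> {\<mu> \<in> topspace T. F \<mu> \<in> {F \<nu> - e / 2<..}}"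
        using \<nu> e by auto
      then have "\<Phi> \<nu> \<in> W" unfolding W by simp
      then obtain \<rho> where \<rho>: "0 < \<rho>" "ball (\<Phi> \<nu>) \<rho> \<subseteq> W"
        using W(1) open_contains_ball by metis
      obtain m0 :: nat where m0: "2 * B / \<rho> \<le> real m0"
        using real_arch_simple by blast
      have "norm (h m (\<Phi> \<nu>) - F \<nu>) < e" if m: "m \<ge> m0" for m
      proof -
        have "F \<nu> - e / 2 \<le> h m (\<Phi> \<nu>)"
        proof (rule h_greatest)
          fix \<mu> assume \<mu>: "\<mu> \<in> topspace T"
          show "F \<nu> - e / 2 \<le> F \<mu> + real m * dist (\<Phi> \<nu>) (\<Phi> \<mu>)"
          proof (cases "dist (\<Phi> \<nu>) (\<Phi> \<mu>) < \<rho>")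
            case True
            then have "\<Phi> \<mu> \<in> W" using \<rho> by auto
            then have "F \<nu> - e / 2 < F \<mu>" using W(2) \<mu> by auto
            then show ?thesis
              using mult_nonneg_nonneg[of "real m" "dist (\<Phi> \<nu>) (\<Phi> \<mu>)", OF of_nat_0_le_iff zero_le_dist]
              by linarith
          next
            case False
            have "2 * B \<le> real m * \<rho>"
              using m0 m \<rho>(1) order_trans[of "2 * B / \<rho>" "real m0" "real m"] by (simp add: pos_divide_le_eq)
            also have "\<dots> \<le> real m * dist (\<Phi> \<nu>) (\<Phi> \<mu>)"
              using False by (intro mult_left_mono) auto
            finally show ?thesis
              using B(1)[OF \<nu>] B(1)[OF \<mu>] e by (auto simp: abs_le_iff)
          qed
        qed
        moreover have "h m (\<Phi> \<nu>) \<le> F \<nu>" using h_le[OF \<nu>, of m "\<Phi> \<nu>"] by simp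
        ultimately show ?thesis using e by auto
      qed
      then show "\<exists>m0. \<forall>m\<ge>m0. norm (h m (\<Phi> \<nu>) - F \<nu>) < e" by blast
    qed
    let ?A = "{\<omega> \<in> space N. \<zeta> \<omega> \<in> topspace T}"
    have "(\<lambda>m. expectation_of N T (\<lambda>\<mu>. h m (\<Phi> \<mu>)) \<zeta>) \<longlonglongrightarrow> expectation_of N T F \<zeta>"
      unfolding expectation_of_def set_lebesgue_integral_def
    proof (rule integral_dominated_convergence[where w = "\<lambda>_. B"])
      show "integrable N (\<lambda>_. B)"
        using prob_space.finite_measure[OF N] by (simp add: finite_measure.integrable_const)
      show "(\<lambda>\<omega>. indicator ?A \<omega> *\<^sub>R F (\<zeta> \<omega>)) \<in> borel_measurable N"
        by (rule random_element_borel_measurable[OF re' F])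
      show "(\<lambda>\<omega>. indicator ?A \<omega> *\<^sub>R h m (\<Phi> (\<zeta> \<omega>))) \<in> borel_measurable N" for m
        by (rule random_element_borel_measurable[OF re' cont_comp[OF ch]])
      show "AE \<omega> in N. (\<lambda>m. indicator ?A \<omega> *\<^sub>R h m (\<Phi> (\<zeta> \<omega>))) \<longlonglongrightarrow> indicator ?A \<omega> *\<^sub>R F (\<zeta> \<omega>)"
        by (rule AE_I2) (auto simp: indicator_def intro: h_lim)
      have "\<bar>h m (\<Phi> \<nu>)\<bar> \<le> B" if "\<nu> \<in> topspace T" for m \<nu>
        using h_le[OF that, of m "\<Phi> \<nu>"] B(1)[OF that] h_greatest[of "- B" m "\<Phi> \<nu>"] ge
        by (auto simp: abs_le_iff)
      then show "AE \<omega> in N. norm (indicator ?A \<omega> *\<^sub>R h m (\<Phi> (\<zeta> \<omega>))) \<le> B" for m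
        using B(2) by (auto simp: indicator_def less_imp_le)
    qed
    from LIMSEQ_D[OF this, of "e / 2"] e
    obtain m where m: "\<bar>expectation_of N T (\<lambda>\<mu>. h m (\<Phi> \<mu>)) \<zeta> - expectation_of N T F \<zeta>\<bar> < e / 2"
      by auto
    have "eventually (\<lambda>n. \<bar>expectation_of M T (\<lambda>\<mu>. h m (\<Phi> \<mu>)) (\<xi> n) - expectation_of N T (\<lambda>\<mu>. h m (\<Phi> \<mu>)) \<zeta>\<bar> < e / 2) sequentially"
      using tendstoD[OF cts[OF ch[of m]], of "e / 2"] e by (simp add: dist_real_def)
    then show ?thesis
    proof eventually_elim
      case (elim n)
      have "expectation_of M T (\<lambda>\<mu>. h m (\<Phi> \<mu>)) (\<xi> n) \<le> expectation_of M T F (\<xi> n)"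
        using h_le[of _ m] by (intro expectation_of_mono[OF M re] cont_comp bdd_comp ch F bF)
          (metis dist_self mult_zero_right add.right_neutral)
      with elim m show ?case by linarith
    qed
  qed
  have "(\<lambda>n. expectation_of M T F (\<xi> n)) \<longlonglongrightarrow> expectation_of N T F \<zeta>"
    if F: "continuous_map T euclideanreal F" and bF: "bounded (F ` topspace T)" for F
  proof (rule tendstoI)
    fix e :: real assume e: "0 < e"
    have F': "continuous_map T euclideanreal (\<lambda>\<mu>. - 1 * F \<mu>)"
      using F by (intro continuous_intros)
    have bF': "bounded ((\<lambda>\<mu>. - 1 * F \<mu>) ` topspace T)"
      using bF by (auto simp: bounded_iff)
    show "eventually (\<lambda>n. dist (expectation_of M T F (\<xi> n)) (expectation_of N T F \<zeta>) < e) sequentially"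
      using lower[OF F bF e] lower[OF F' bF' e]
      unfolding expectation_of_cmult by eventually_elim (auto simp: dist_real_def)
  qed
  then show ?thesis
    unfolding converges_in_distribution_def using re re' by blast
qed

section \<open>The vague topology is induced by countably many integrals\<close>

lemma vague_test_function_bounded:
  assumes "f \<in> vague_test_functions E"
  obtains B where "0 < B" "\<And>x. x \<in> E \<Longrightarrow> \<bar>f x\<bar> \<le> B"
proof -
  have "bounded (f ` E)" using assms by (simp add: vague_test_functions_def)
  then obtain B where "0 < B" "\<forall>y\<in>f ` E. norm y \<le> B" unfolding bounded_pos by blast
  then show ?thesis by (intro that[of B]) auto
qed

lemma vague_test_functions_zero: "(\<lambda>_. 0) \<in> vague_test_functions E"
  by (auto simp: vague_test_functions_def relatively_compact_in_def image_constant_conv intro: exI[of _ 1])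

lemma topspace_vague_topology: "topspace (vague_topology E) = locally_finite_measures E"
proof -
  have "\<exists>f U. locally_finite_measures E =
      {\<mu> \<in> locally_finite_measures E. (\<integral>x. f x \<partial>\<mu>) \<in> U} \<and> f \<in> vague_test_functions E \<and> open U"
    using vague_test_functions_zero by (intro exI[of _ "\<lambda>_. 0"] exI[of _ UNIV]) auto
  then show ?thesis
    unfolding vague_topology_def topology_generated_by_topspace by blast
qed

lemma continuous_map_vague_integral:
  assumes "f \<in> vague_test_functions E"
  shows "continuous_map (vague_topology E) euclideanreal (\<lambda>\<mu>. \<integral>x. f x \<partial>\<mu>)"
  unfolding continuous_map_def topspace_vague_topology
proof safe
  fix U :: "real set" assume "openin euclideanreal U"
  then show "openin (vague_topology E) {\<mu> \<in> locally_finite_measures E. (\<integral>x. f x \<partial>\<mu>) \<in> U}"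
    unfolding vague_topology_def using assms by (intro topology_generated_by_Basis) auto
qed auto

lemma continuous_map_laplace:
  assumes "f \<in> vague_test_functions E"
  shows "continuous_map (vague_topology E) euclideanreal (\<lambda>\<mu>. exp (- (\<integral>x. f x \<partial>\<mu>)))"
  using continuous_map_compose[OF continuous_map_vague_integral[OF assms], of euclideanreal "\<lambda>t. exp (- t)"]
  by (simp add: o_def continuous_intros)

lemma space_locally_finite: "\<mu> \<in> locally_finite_measures E \<Longrightarrow> space \<mu> = E"
  using sets_eq_imp_space_eq[of \<mu> "borel_on E"]
  by (auto simp: locally_finite_measures_def space_restrict_space)

lemma vague_test_function_measurable:
  assumes "f \<in> vague_test_functions E"
  shows "f \<in> borel_measurable (borel_on E)"
  using assms unfolding vague_test_functions_def
  by (auto intro: borel_measurable_continuous_on_restrict)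

lemma relatively_compact_in_subset:
  "relatively_compact_in E A \<Longrightarrow> B \<subseteq> A \<Longrightarrow> relatively_compact_in E B"
  unfolding relatively_compact_in_def by (meson bounded_subset subset_iff order_trans)

lemma relatively_compact_in_Un:
  assumes "relatively_compact_in E A" "relatively_compact_in E B"
  shows "relatively_compact_in E (A \<union> B)"
proof -
  obtain \<delta> \<delta>' where "0 < \<delta>" "\<forall>x\<in>A. \<delta> \<le> norm x" "0 < \<delta>'" "\<forall>x\<in>B. \<delta>' \<le> norm x"
    using assms unfolding relatively_compact_in_def by auto
  then have "\<exists>\<delta>>0. \<forall>x\<in>A \<union> B. \<delta> \<le> norm x"
    by (intro exI[of _ "min \<delta> \<delta>'"]) auto
  then show ?thesis
    using assms unfolding relatively_compact_in_def by auto
qed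

text \<open>
Membership of the constructed functions in the class of test functions is inherited from a test
function above them, which bounds them and contains their support.
\<close>

lemma vague_test_functions_dominated:
  assumes f: "f \<in> vague_test_functions E" and cont: "continuous_on E g"
    and "\<And>x. x \<in> E \<Longrightarrow> 0 \<le> g x" and le: "\<And>x. x \<in> E \<Longrightarrow> g x \<le> a * f x"
  shows "g \<in> vague_test_functions E"
proof -
  obtain B where B: "\<And>x. x \<in> E \<Longrightarrow> \<bar>f x\<bar> \<le> B"
    using vague_test_function_bounded[OF f] by blast
  have "\<bar>g x\<bar> \<le> \<bar>a\<bar> * B" if "x \<in> E" for x
  proof -
    have "g x \<le> \<bar>a\<bar> * \<bar>f x\<bar>"
      using le[OF that] abs_ge_self[of "a * f x"] by (simp add: abs_mult)
    also have "\<dots> \<le> \<bar>a\<bar> * B" using B[OF that] by (intro mult_left_mono) auto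
    finally show ?thesis using assms(3)[OF that] by simp
  qed
  then have "bounded (g ` E)" unfolding bounded_iff by auto
  moreover have "{x \<in> E. g x \<noteq> 0} \<subseteq> {x \<in> E. f x \<noteq> 0}"
    using assms(3) le by (force dest: antisym)
  then have "relatively_compact_in E {x \<in> E. g x \<noteq> 0}"
    using f relatively_compact_in_subset unfolding vague_test_functions_def by blast
  ultimately show ?thesis
    using cont assms(3) unfolding vague_test_functions_def by auto
qed

lemma vague_test_functions_add:
  assumes f: "f \<in> vague_test_functions E" and g: "g \<in> vague_test_functions E"
  shows "(\<lambda>x. f x + g x) \<in> vague_test_functions E"
proof -
  have "relatively_compact_in E {x \<in> E. f x + g x \<noteq> 0}"
    by (rule relatively_compact_in_subset[OF relatively_compact_in_Un, of _ "{x \<in> E. f x \<noteq> 0}" "{x \<in> E. g x \<noteq> 0}"])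
      (use f g in \<open>auto simp: vague_test_functions_def\<close>)
  then show ?thesis
    using f g bounded_plus_comp[of f E g] unfolding vague_test_functions_def
    by (auto intro: continuous_intros)
qed

lemma vague_test_function_integrable:
  assumes f: "f \<in> vague_test_functions E" and \<mu>: "\<mu> \<in> locally_finite_measures E"
  shows "integrable \<mu> f"
proof -
  have sets: "sets \<mu> = sets (borel_on E)"
    using \<mu> by (auto simp: locally_finite_measures_def)
  have f_meas [measurable]: "f \<in> borel_measurable \<mu>"
    using vague_test_function_measurable[OF f] measurable_cong_sets[OF sets refl] by blast
  obtain B where B: "\<And>x. x \<in> E \<Longrightarrow> \<bar>f x\<bar> \<le> B"
    using vague_test_function_bounded[OF f] by blast
  have "{x \<in> space \<mu>. f x \<noteq> 0} \<in> sets \<mu>" by measurable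
  then have A: "{x \<in> E. f x \<noteq> 0} \<in> sets \<mu>" using space_locally_finite[OF \<mu>] by simp
  then have "emeasure \<mu> {x \<in> E. f x \<noteq> 0} < \<infinity>"
    using f \<mu> unfolding vague_test_functions_def locally_finite_measures_def by auto
  then show ?thesis
    by (rule integrableI_bounded_set[OF A f_meas, where B = B])
      (use B space_locally_finite[OF \<mu>] in auto)
qed

lemma vague_integral_mono:
  assumes "f \<in> vague_test_functions E" "g \<in> vague_test_functions E"
    and "\<mu> \<in> locally_finite_measures E" and "\<And>x. x \<in> E \<Longrightarrow> f x \<le> g x"
  shows "(\<integral>x. f x \<partial>\<mu>) \<le> (\<integral>x. g x \<partial>\<mu>)"
  by (rule integral_mono)
    (auto simp: space_locally_finite[OF assms(3)] assms(4) intro: vague_test_function_integrable assms)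

lemma vague_integral_nonneg:
  assumes "f \<in> vague_test_functions E" and "\<mu> \<in> locally_finite_measures E"
  shows "0 \<le> (\<integral>x. f x \<partial>\<mu>)"
  by (rule Bochner_Integration.integral_nonneg)
    (use assms space_locally_finite in \<open>auto simp: vague_test_functions_def\<close>)

definition bump :: "real \<Rightarrow> real \<Rightarrow> 'a::metric_space \<Rightarrow> 'a \<Rightarrow> real" where
  "bump a s q x = max 0 (a - s * dist x q)"

text \<open>
Cones with rational height and slope, centred in a countable dense set: a nonnegative continuous
function is the pointwise supremum of the cones below it.
\<close>

lemma countable_bumps_approximate:
  obtains B :: "('a::{metric_space, second_countable_topology} \<Rightarrow> real) set"
  where "countable B" "(\<lambda>_. 0) \<in> B" "\<And>b S. b \<in> B \<Longrightarrow> continuous_on S b"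
    and "\<And>E f x e. continuous_on E f \<Longrightarrow> (\<And>y. y \<in> E \<Longrightarrow> 0 \<le> f y) \<Longrightarrow> x \<in> E \<Longrightarrow> 0 < e \<Longrightarrow>
      \<exists>b\<in>B. (\<forall>y\<in>E. b y \<le> f y) \<and> f x - e < b x"
proof -
  obtain D :: "'a set" where D: "countable D" "\<And>X. open X \<Longrightarrow> X \<noteq> {} \<Longrightarrow> \<exists>d\<in>D. d \<in> X"
    using countable_dense_exists by blast
  define B where "B = (\<lambda>(a, s, q). bump a s q) ` (\<rat> \<times> \<rat> \<times> D)"
  have zero: "(\<lambda>_. 0) \<in> B"
  proof -
    obtain q where "q \<in> D" using D(2)[of UNIV] by auto
    moreover have "bump 0 0 q = (\<lambda>_. 0)" by (auto simp: bump_def)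
    ultimately show ?thesis unfolding B_def by (intro image_eqI[of _ _ "(0, 0, q)"]) auto
  qed
  show ?thesis
  proof (rule that)
    show "countable B" unfolding B_def by (intro countable_image countable_SIGMA D countable_rat)
    show "(\<lambda>_. 0) \<in> B" by fact
    show "continuous_on S b" if "b \<in> B" for b S
      using that unfolding B_def bump_def by (auto intro!: continuous_intros)
    fix E :: "'a set" and f :: "'a \<Rightarrow> real" and x and e :: real
    assume f: "continuous_on E f" "\<And>y. y \<in> E \<Longrightarrow> 0 \<le> f y" and x: "x \<in> E" and e: "0 < e"
    show "\<exists>b\<in>B. (\<forall>y\<in>E. b y \<le> f y) \<and> f x - e < b x"
    proof (cases "f x < e")
      case True
      then show ?thesis using f zero by (intro bexI[of _ "\<lambda>_. 0"]) auto
    next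
      case False
      obtain \<delta> where \<delta>: "0 < \<delta>" "\<And>y. y \<in> E \<Longrightarrow> dist y x < \<delta> \<Longrightarrow> dist (f y) (f x) < e / 4"
        using f(1) x e unfolding continuous_on_iff by (metis divide_pos_pos zero_less_numeral)
      \<comment> \<open>The height \<open>a\<close> stays below \<open>f\<close> on the \<open>\<delta>\<close>-ball. The slope \<open>s\<close> makes the cone vanish
        at distance \<open>\<delta> / 2\<close> from its centre \<open>q\<close>, and \<open>q\<close> is so close to \<open>x\<close> that
        at most \<open>e / 4\<close> of the height is lost there.\<close>
      obtain a where a: "a \<in> \<rat>" "f x - e / 2 < a" "a < f x - e / 4"
        using Rats_dense_in_real[of "f x - e / 2" "f x - e / 4"] e by auto
      obtain s where s: "s \<in> \<rat>" "max 1 (2 * a / \<delta>) < s"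
        using Rats_dense_in_real[of "max 1 (2 * a / \<delta>)" "max 1 (2 * a / \<delta>) + 1"] by auto
      then have s': "0 < s" "a < s * (\<delta> / 2)"
        using \<delta>(1) by (auto simp: field_simps)
      obtain q where q: "q \<in> D" "q \<in> ball x (min (\<delta> / 2) (e / (4 * s)))"
        using D(2)[of "ball x (min (\<delta> / 2) (e / (4 * s)))"] \<delta>(1) e s'(1)
        by (metis ball_eq_empty divide_pos_pos leD min_less_iff_conj mult_pos_pos open_ball zero_less_numeral)
      have "s * dist x q < e / 4"
        using q(2) s'(1) by (auto simp: field_simps)
      then have "f x - e < bump a s q x"
        using a e unfolding bump_def by auto
      moreover have "bump a s q y \<le> f y" if y: "y \<in> E" for y
      proof (cases "dist y x < \<delta>")
        case True
        have "a - s * dist y q \<le> a" using s'(1) by simp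
        also have "a \<le> f y" using \<delta>(2)[OF y True] a unfolding dist_real_def by linarith
        finally show ?thesis using f(2)[OF y] unfolding bump_def by simp
      next
        case False
        have "\<delta> / 2 \<le> dist y q"
          using dist_triangle[of y x q] False q(2) by (auto simp: dist_commute)
        then have "s * (\<delta> / 2) \<le> s * dist y q"
          using s'(1) by (intro mult_left_mono) auto
        then show ?thesis using s'(2) f(2)[OF y] unfolding bump_def by auto
      qed
      moreover have "bump a s q \<in> B"
        unfolding B_def using a s q by (intro image_eqI[of _ _ "(a, s, q)"]) auto
      ultimately show ?thesis by blast
    qed
  qed
qed

primrec upper_envelope :: "('a \<Rightarrow> real) list \<Rightarrow> 'a \<Rightarrow> real" where
  "upper_envelope [] x = 0"
| "upper_envelope (b # bs) x = max (b x) (upper_envelope bs x)"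

lemma upper_envelope_ge: "b \<in> set bs \<Longrightarrow> b x \<le> upper_envelope bs x"
  by (induction bs) auto

lemma upper_envelope_nonneg: "0 \<le> upper_envelope bs x"
  by (induction bs) auto

lemma upper_envelope_le: "0 \<le> u \<Longrightarrow> (\<And>b. b \<in> set bs \<Longrightarrow> b x \<le> u) \<Longrightarrow> upper_envelope bs x \<le> u"
  by (induction bs) auto

lemma continuous_on_upper_envelope:
  fixes bs :: "('a::topological_space \<Rightarrow> real) list"
  shows "(\<And>b. b \<in> set bs \<Longrightarrow> continuous_on S b) \<Longrightarrow> continuous_on S (upper_envelope bs)"
  by (induction bs) (auto intro!: continuous_intros)

text \<open>
Countably many test functions that dominate all others up to a factor. The summand \<open>1\<close> keeps the
denominators positive for \<open>m = 0\<close>.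
\<close>

definition cutoff :: "nat \<Rightarrow> 'a::real_normed_vector \<Rightarrow> real" where
  "cutoff m x = max 0 (min 1 (min (2 - norm x / (1 + real m)) (2 * (1 + real m) * norm x - 1)))"

lemma cutoff_nonneg: "0 \<le> cutoff m x"
  by (simp add: cutoff_def)

lemma cutoff_test_function: "cutoff m \<in> vague_test_functions E"
proof -
  have "norm x \<le> 2 * (1 + real m)" "1 / (2 * (1 + real m)) \<le> norm x" if "cutoff m x \<noteq> 0" for x :: 'a
  proof -
    have "0 < 2 - norm x / (1 + real m)" "0 < 2 * (1 + real m) * norm x - 1"
      using that unfolding cutoff_def by linarith+
    then show "norm x \<le> 2 * (1 + real m)" "1 / (2 * (1 + real m)) \<le> norm x"
      by (auto simp: pos_divide_le_eq pos_divide_less_eq mult.commute)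
  qed
  then have "relatively_compact_in E {x \<in> E. cutoff m x \<noteq> 0}"
    unfolding relatively_compact_in_def bounded_iff
  proof (intro conjI)
    show "\<exists>R. \<forall>x\<in>{x \<in> E. cutoff m x \<noteq> 0}. norm x \<le> R"
      using \<open>\<And>x. cutoff m x \<noteq> 0 \<Longrightarrow> norm x \<le> 2 * (1 + real m)\<close> by blast
    show "\<exists>\<delta>>0. \<forall>x\<in>{x \<in> E. cutoff m x \<noteq> 0}. \<delta> \<le> norm x"
      using \<open>\<And>x. cutoff m x \<noteq> 0 \<Longrightarrow> 1 / (2 * (1 + real m)) \<le> norm x\<close>
      by (intro exI[of _ "1 / (2 * (1 + real m))"]) auto
  qed auto
  moreover have "bounded (cutoff m ` E)"
    unfolding bounded_iff by (intro exI[of _ 1]) (auto simp: cutoff_def)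
  moreover have "continuous_on E (cutoff m)"
    unfolding cutoff_def by (intro continuous_intros) auto
  ultimately show ?thesis
    by (auto simp: vague_test_functions_def cutoff_nonneg)
qed

lemma cutoff_eq_1:
  assumes "1 / (1 + real m) \<le> norm x" "norm x \<le> 1 + real m"
  shows "cutoff m x = 1"
  using assms by (auto simp: cutoff_def max_def min_def field_simps)

lemma vague_test_function_support:
  assumes "f \<in> vague_test_functions E"
  obtains \<delta> R where "0 < \<delta>" "\<And>x. x \<in> E \<Longrightarrow> f x \<noteq> 0 \<Longrightarrow> \<delta> \<le> norm x \<and> norm x \<le> R"
  using assms unfolding vague_test_functions_def relatively_compact_in_def bounded_iff by blast

lemma vague_test_function_le_cutoff:
  assumes f: "f \<in> vague_test_functions E"
  obtains a m where "\<And>x. x \<in> E \<Longrightarrow> f x \<le> a * cutoff m x"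
proof -
  obtain B where B: "\<And>x. x \<in> E \<Longrightarrow> \<bar>f x\<bar> \<le> B" "0 < B"
    using vague_test_function_bounded[OF f] by blast
  obtain \<delta> R where \<delta>: "0 < \<delta>" and R: "\<And>x. x \<in> E \<Longrightarrow> f x \<noteq> 0 \<Longrightarrow> \<delta> \<le> norm x \<and> norm x \<le> R"
    using vague_test_function_support[OF f] by blast
  obtain m :: nat where m: "max R (1 / \<delta>) \<le> real m" using real_arch_simple by blast
  have "f x \<le> B * cutoff m x" if x: "x \<in> E" for x
  proof (cases "f x = 0")
    case True
    then show ?thesis using B(2) cutoff_nonneg[of m x] by simp
  next
    case False
    have "1 / (1 + real m) \<le> \<delta>" using m \<delta> by (auto simp: field_simps)
    then have "cutoff m x = 1"
      using R[OF x False] m by (intro cutoff_eq_1) auto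
    then show ?thesis using B(1)[OF x] by auto
  qed
  then show ?thesis using that by blast
qed

text \<open>
The functions \<open>g\<close> enumerate the cutoffs and those finite maxima of cones that are test functions. Let
\<open>T\<close> be the topology they induce. For a test function \<open>f\<close>, the integral \<open>\<integral> f d\<mu>\<close> is the supremum of the
integrals of the finite maxima of cones below \<open>f\<close>, hence lower semicontinuous for \<open>T\<close>. Applied to
\<open>c * cutoff m - f\<close>, which is a test function for suitable \<open>c\<close> and \<open>m\<close>, this also gives upper
semicontinuity, because the integral of the cutoff is continuous for \<open>T\<close>. So \<open>T\<close> is as fine as the
vague topology.
\<close>

lemma vague_topology_countably_generated:
  fixes E :: "'a::euclidean_space set"
  obtains g :: "nat \<Rightarrow> 'a \<Rightarrow> real"
  where "\<And>j. g j \<in> vague_test_functions E"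
    and "\<And>U. openin (vague_topology E) U \<Longrightarrow>
      \<exists>W. open W \<and> U = {\<mu> \<in> topspace (vague_topology E). (\<lambda>j. exp (- (\<integral>x. g j x \<partial>\<mu>))) \<in> W}"
proof -
  obtain B :: "('a \<Rightarrow> real) set"
    where B: "countable B" "(\<lambda>_. 0) \<in> B" "\<And>b S. b \<in> B \<Longrightarrow> continuous_on S b"
    and approx: "\<And>E f x e. continuous_on E f \<Longrightarrow> (\<And>y. y \<in> E \<Longrightarrow> 0 \<le> f y) \<Longrightarrow> x \<in> E \<Longrightarrow> 0 < e \<Longrightarrow>
      \<exists>b\<in>B. (\<forall>y\<in>E. b y \<le> f y) \<and> f x - e < b x"
    by (rule countable_bumps_approximate) blast
  define G where "G = (upper_envelope ` lists B \<union> range cutoff) \<inter> vague_test_functions E"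
  have "countable G"
    unfolding G_def by (intro countable_Int1 countable_Un countable_image countable_lists B) auto
  have cutoff_G: "cutoff m \<in> G" for m
    unfolding G_def using cutoff_test_function by blast
  then have "G \<noteq> {}" by blast
  define g where "g = from_nat_into G"
  have range_g: "range g = G"
    unfolding g_def by (rule range_from_nat_into) fact+
  have g: "g j \<in> vague_test_functions E" for j
    using range_g unfolding G_def by blast
  define \<Phi> where "\<Phi> \<mu> = (\<lambda>j. exp (- (\<integral>x. g j x \<partial>\<mu>)))" for \<mu>
  define T where "T = pullback_topology (locally_finite_measures E) \<Phi> euclidean"
  have topT: "topspace T = locally_finite_measures E"
    unfolding T_def topspace_pullback_topology by simp
  have cont_Phi: "continuous_map T euclideanreal (\<lambda>\<mu>. \<Phi> \<mu> j)" for j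
    using continuous_map_pullback[of euclidean euclideanreal "\<lambda>x. x j" "locally_finite_measures E" \<Phi>]
    by (simp add: T_def o_def continuous_on_product_coordinates)
  have cont_G: "continuous_map T euclideanreal (\<lambda>\<mu>. \<integral>x. h x \<partial>\<mu>)" if h: "h \<in> G" for h
  proof -
    obtain j where j: "h = g j" using h range_g by auto
    have "{\<mu> \<in> topspace T. a < (\<integral>x. h x \<partial>\<mu>)} = {\<mu> \<in> topspace T. \<Phi> \<mu> j < exp (- a)}"
      and "{\<mu> \<in> topspace T. (\<integral>x. h x \<partial>\<mu>) < a} = {\<mu> \<in> topspace T. exp (- a) < \<Phi> \<mu> j}" for a
      by (auto simp: \<Phi>_def j)
    then show ?thesis
      using cont_Phi[of j] unfolding continuous_map_upper_lower_semicontinuous_lt by simp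
  qed
  have lsc: "openin T {\<mu> \<in> topspace T. a < (\<integral>x. f x \<partial>\<mu>)}" if f: "f \<in> vague_test_functions E" for f a
  proof -
    have f': "continuous_on E f" "\<And>y. y \<in> E \<Longrightarrow> 0 \<le> f y"
      using f by (auto simp: vague_test_functions_def)
    define Bf where "Bf = {b \<in> B. \<forall>y\<in>E. b y \<le> f y}"
    have "countable Bf" "Bf \<noteq> {}"
      using B f' unfolding Bf_def by (auto intro: countable_subset[of _ B])
    then have range_b: "range (from_nat_into Bf) = Bf"
      by (intro range_from_nat_into)
    define env where "env n = upper_envelope (map (from_nat_into Bf) [0..<n])" for n
    have env_le: "env n x \<le> f x" if "x \<in> E" for n x
      unfolding env_def using range_b f'(2) that by (intro upper_envelope_le) (auto simp: Bf_def)
    have env_cont: "continuous_on E (env n)" for n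
      unfolding env_def using range_b by (intro continuous_on_upper_envelope B) (auto simp: Bf_def)
    have env_test: "env n \<in> vague_test_functions E" for n
      by (rule vague_test_functions_dominated[OF f, where a = 1])
        (use env_le env_cont upper_envelope_nonneg in \<open>auto simp: env_def\<close>)
    have env_G: "env n \<in> G" for n
    proof -
      have "set (map (from_nat_into Bf) [0..<n]) \<subseteq> B" using range_b unfolding Bf_def by auto
      then have "env n \<in> upper_envelope ` lists B" unfolding env_def by (intro imageI in_listsI) blast
      then show ?thesis using env_test unfolding G_def by blast
    qed
    have env_lim: "(\<lambda>n. env n x) \<longlonglongrightarrow> f x" if x: "x \<in> E" for x
    proof (rule LIMSEQ_I)
      fix e :: real assume "0 < e"
      then obtain b where b: "b \<in> Bf" "f x - e < b x"
        using approx[OF f' x] unfolding Bf_def by blast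
      then obtain i where i: "b = from_nat_into Bf i" using range_b by (metis imageE)
      have "norm (env n x - f x) < e" if "n \<ge> Suc i" for n
      proof -
        have "b x \<le> env n x"
          unfolding env_def i using that by (intro upper_envelope_ge) auto
        then show ?thesis using b env_le[OF x, of n] by auto
      qed
      then show "\<exists>n0. \<forall>n\<ge>n0. norm (env n x - f x) < e" by blast
    qed
    have int_lim: "(\<lambda>n. \<integral>x. env n x \<partial>\<mu>) \<longlonglongrightarrow> (\<integral>x. f x \<partial>\<mu>)" if \<mu>: "\<mu> \<in> locally_finite_measures E" for \<mu>
    proof (rule integral_dominated_convergence[where w = f])
      show "integrable \<mu> f" by (rule vague_test_function_integrable[OF f \<mu>])
      then show "f \<in> borel_measurable \<mu>" by simp
      show "env n \<in> borel_measurable \<mu>" for n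
        using vague_test_function_integrable[OF env_test \<mu>] by simp
      show "AE x in \<mu>. (\<lambda>n. env n x) \<longlonglongrightarrow> f x"
        using env_lim space_locally_finite[OF \<mu>] by auto
      show "AE x in \<mu>. norm (env n x) \<le> f x" for n
        using env_le space_locally_finite[OF \<mu>] upper_envelope_nonneg[of "map (from_nat_into Bf) [0..<n]"]
        by (auto simp: env_def)
    qed
    have "{\<mu> \<in> topspace T. a < (\<integral>x. f x \<partial>\<mu>)} = (\<Union>n. {\<mu> \<in> topspace T. a < (\<integral>x. env n x \<partial>\<mu>)})"
    proof (intro set_eqI iffI)
      fix \<mu> assume "\<mu> \<in> {\<mu> \<in> topspace T. a < (\<integral>x. f x \<partial>\<mu>)}"
      then have "\<mu> \<in> topspace T" "eventually (\<lambda>n. a < (\<integral>x. env n x \<partial>\<mu>)) sequentially"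
        using order_tendstoD(1)[OF int_lim] topT by auto
      then show "\<mu> \<in> (\<Union>n. {\<mu> \<in> topspace T. a < (\<integral>x. env n x \<partial>\<mu>)})"
        by (auto simp: eventually_sequentially)
    next
      fix \<mu> assume "\<mu> \<in> (\<Union>n. {\<mu> \<in> topspace T. a < (\<integral>x. env n x \<partial>\<mu>)})"
      then obtain n where "\<mu> \<in> topspace T" "a < (\<integral>x. env n x \<partial>\<mu>)" by auto
      moreover have "(\<integral>x. env n x \<partial>\<mu>) \<le> (\<integral>x. f x \<partial>\<mu>)"
        using calculation topT env_le by (intro vague_integral_mono[OF env_test f]) auto
      ultimately show "\<mu> \<in> {\<mu> \<in> topspace T. a < (\<integral>x. f x \<partial>\<mu>)}" by auto
    qed
    moreover have "openin T {\<mu> \<in> topspace T. a < (\<integral>x. env n x \<partial>\<mu>)}" for n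
      using cont_G[OF env_G] unfolding continuous_map_upper_lower_semicontinuous_lt by blast
    ultimately show ?thesis by auto
  qed
  have usc: "openin T {\<mu> \<in> topspace T. (\<integral>x. f x \<partial>\<mu>) < a}" if f: "f \<in> vague_test_functions E" for f a
  proof -
    obtain c m where le: "\<And>x. x \<in> E \<Longrightarrow> f x \<le> c * cutoff m x"
      using vague_test_function_le_cutoff[OF f] by blast
    define h where "h x = c * cutoff m x - f x" for x
    have h: "h \<in> vague_test_functions E"
    proof (rule vague_test_functions_dominated[OF cutoff_test_function[of m]])
      show "continuous_on E h"
        using f cutoff_test_function[of m E] unfolding h_def vague_test_functions_def
        by (auto intro!: continuous_intros)
      show "0 \<le> h x" "h x \<le> c * cutoff m x" if "x \<in> E" for x
        using le f that by (auto simp: h_def vague_test_functions_def)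
    qed
    have "(\<integral>x. f x \<partial>\<mu>) = c * (\<integral>x. cutoff m x \<partial>\<mu>) - (\<integral>x. h x \<partial>\<mu>)" if "\<mu> \<in> topspace T" for \<mu>
      using vague_test_function_integrable[OF f] vague_test_function_integrable[OF cutoff_test_function, of \<mu> E m] that
      unfolding topT h_def by simp
    then have "{\<mu> \<in> topspace T. (\<integral>x. f x \<partial>\<mu>) < a} =
      (\<Union>s. {\<mu> \<in> topspace T. c * (\<integral>x. cutoff m x \<partial>\<mu>) < s} \<inter> {\<mu> \<in> topspace T. s - a < (\<integral>x. h x \<partial>\<mu>)})"
      (is "_ = (\<Union>s. ?P s \<inter> ?Q s)")
    proof (intro set_eqI iffI)
      fix \<mu> assume eq: "\<And>\<mu>. \<mu> \<in> topspace T \<Longrightarrow> (\<integral>x. f x \<partial>\<mu>) = c * (\<integral>x. cutoff m x \<partial>\<mu>) - (\<integral>x. h x \<partial>\<mu>)"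
        and \<mu>: "\<mu> \<in> {\<mu> \<in> topspace T. (\<integral>x. f x \<partial>\<mu>) < a}"
      then have "c * (\<integral>x. cutoff m x \<partial>\<mu>) < (\<integral>x. h x \<partial>\<mu>) + a" by auto
      then obtain s where "c * (\<integral>x. cutoff m x \<partial>\<mu>) < s" "s < (\<integral>x. h x \<partial>\<mu>) + a"
        using dense by blast
      then show "\<mu> \<in> (\<Union>s. ?P s \<inter> ?Q s)" using \<mu> by (auto intro!: exI[of _ s])
    next
      fix \<mu> assume "\<And>\<mu>. \<mu> \<in> topspace T \<Longrightarrow> (\<integral>x. f x \<partial>\<mu>) = c * (\<integral>x. cutoff m x \<partial>\<mu>) - (\<integral>x. h x \<partial>\<mu>)"
        and "\<mu> \<in> (\<Union>s. ?P s \<inter> ?Q s)"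
      then show "\<mu> \<in> {\<mu> \<in> topspace T. (\<integral>x. f x \<partial>\<mu>) < a}" by auto
    qed
    moreover have "openin T (?P s \<inter> ?Q s)" for s
    proof (intro openin_Int lsc h)
      have "continuous_map T euclideanreal (\<lambda>\<mu>. c * (\<integral>x. cutoff m x \<partial>\<mu>))"
        by (intro continuous_intros cont_G cutoff_G)
      then show "openin T (?P s)"
        unfolding continuous_map_upper_lower_semicontinuous_lt by blast
    qed
    ultimately show ?thesis by auto
  qed
  have "continuous_map T (vague_topology E) (\<lambda>\<mu>. \<mu>)"
    unfolding vague_topology_def
  proof (rule continuous_on_generated_topo)
    fix S assume "S \<in> {{\<mu> \<in> locally_finite_measures E. (\<integral>x. f x \<partial>\<mu>) \<in> U} | f U.
        f \<in> vague_test_functions E \<and> open U}"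
    then obtain f U where f: "f \<in> vague_test_functions E" and U: "open U"
      and S: "S = {\<mu> \<in> topspace T. (\<integral>x. f x \<partial>\<mu>) \<in> U}" unfolding topT by blast
    have "continuous_map T euclideanreal (\<lambda>\<mu>. \<integral>x. f x \<partial>\<mu>)"
      using lsc[OF f] usc[OF f] unfolding continuous_map_upper_lower_semicontinuous_lt by blast
    then have "openin T S"
      using U unfolding S by (intro openin_continuous_map_preimage) auto
    moreover have "(\<lambda>\<mu>. \<mu>) -` S \<inter> topspace T = S" unfolding S by auto
    ultimately show "openin T ((\<lambda>\<mu>. \<mu>) -` S \<inter> topspace T)" by simp
  next
    show "(\<lambda>\<mu>. \<mu>) ` topspace T \<subseteq> \<Union> {{\<mu> \<in> locally_finite_measures E. (\<integral>x. f x \<partial>\<mu>) \<in> U} | f U.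
        f \<in> vague_test_functions E \<and> open U}"
      using topspace_vague_topology[of E] unfolding topT vague_topology_def topology_generated_by_topspace
      by simp
  qed
  then have coarser: "openin T U" if "openin (vague_topology E) U" for U
  proof -
    have "openin T {\<mu> \<in> topspace T. \<mu> \<in> U}"
      using \<open>continuous_map T (vague_topology E) (\<lambda>\<mu>. \<mu>)\<close> that by (rule openin_continuous_map_preimage)
    moreover have "{\<mu> \<in> topspace T. \<mu> \<in> U} = U"
      using openin_subset[OF that] unfolding topT topspace_vague_topology by blast
    ultimately show ?thesis by simp
  qed
  show ?thesis
  proof (rule that[OF g])
    fix U assume "openin (vague_topology E) U"
    then have "openin T U" by (rule coarser)
    then show "\<exists>W. open W \<and> U = {\<mu> \<in> topspace (vague_topology E). (\<lambda>j. exp (- (\<integral>x. g j x \<partial>\<mu>))) \<in> W}"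
      unfolding T_def openin_pullback_topology topspace_vague_topology \<Phi>_def by auto
  qed
qed

text \<open>
Test functions are closed under addition, so a monomial in the coordinates
\<open>exp (- \<integral> g j d\<mu>)\<close> is itself of the form \<open>exp (- \<integral> f d\<mu>)\<close>: Laplace functionals are
the moments required by \<open>converges_in_distribution_coordinates\<close>.
\<close>

lemma laplace_convergence_imp_vague_convergence:
  fixes E :: "'a::euclidean_space set"
  assumes M: "prob_space M" and N: "prob_space N"
    and re: "\<And>n. random_element M (vague_topology E) (\<xi> n)"
    and re': "random_element N (vague_topology E) \<zeta>"
    and laplace: "\<And>f. f \<in> vague_test_functions E \<Longrightarrow>
      (\<lambda>n. expectation_of M (vague_topology E) (\<lambda>\<mu>. exp (- (\<integral>x. f x \<partial>\<mu>))) (\<xi> n))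
        \<longlonglongrightarrow> expectation_of N (vague_topology E) (\<lambda>\<mu>. exp (- (\<integral>x. f x \<partial>\<mu>))) \<zeta>"
  shows "vaguely_converges_in_distribution E M \<xi> N \<zeta>"
proof -
  obtain g :: "nat \<Rightarrow> 'a \<Rightarrow> real" where g: "\<And>j. g j \<in> vague_test_functions E"
    and initial: "\<And>U. openin (vague_topology E) U \<Longrightarrow>
      \<exists>W. open W \<and> U = {\<mu> \<in> topspace (vague_topology E). (\<lambda>j. exp (- (\<integral>x. g j x \<partial>\<mu>))) \<in> W}"
    by (rule vague_topology_countably_generated[of E]) blast
  have sums: "(\<lambda>x. \<Sum>j\<leftarrow>js. g j x) \<in> vague_test_functions E" for js
    by (induction js) (auto intro: vague_test_functions_zero vague_test_functions_add g)
  have prods: "prod_list (map (\<lambda>j. exp (- (\<integral>x. g j x \<partial>\<mu>))) js) = exp (- (\<integral>x. (\<Sum>j\<leftarrow>js. g j x) \<partial>\<mu>))"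
    if \<mu>: "\<mu> \<in> locally_finite_measures E" for \<mu> js
  proof (induction js)
    case (Cons j js)
    then show ?case
      using vague_test_function_integrable[OF g \<mu>, of j] vague_test_function_integrable[OF sums \<mu>, of js]
      by (simp add: exp_add[symmetric])
  qed simp
  show ?thesis
  proof (rule converges_in_distribution_coordinates[OF M N _ _ initial re re'])
    show "(\<lambda>j. exp (- (\<integral>x. g j x \<partial>\<mu>))) \<in> unit_cube" if "\<mu> \<in> topspace (vague_topology E)" for \<mu>
      using vague_integral_nonneg[OF g] that by (auto simp: topspace_vague_topology)
    show "continuous_map (vague_topology E) euclideanreal (\<lambda>\<mu>. exp (- (\<integral>x. g j x \<partial>\<mu>)))" for j
      by (rule continuous_map_laplace[OF g])
    fix js
    have cong: "expectation_of L (vague_topology E) (\<lambda>\<mu>. prod_list (map (\<lambda>j. exp (- (\<integral>x. g j x \<partial>\<mu>))) js)) \<theta> =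
       expectation_of L (vague_topology E) (\<lambda>\<mu>. exp (- (\<integral>x. (\<Sum>j\<leftarrow>js. g j x) \<partial>\<mu>))) \<theta>" for L :: "'l measure" and \<theta>
      by (rule expectation_of_cong) (auto simp: prods topspace_vague_topology)
    show "(\<lambda>n. expectation_of M (vague_topology E) (\<lambda>\<mu>. prod_list (map (\<lambda>j. exp (- (\<integral>x. g j x \<partial>\<mu>))) js)) (\<xi> n))
       \<longlonglongrightarrow> expectation_of N (vague_topology E) (\<lambda>\<mu>. prod_list (map (\<lambda>j. exp (- (\<integral>x. g j x \<partial>\<mu>))) js)) \<zeta>"
      unfolding cong by (rule laplace[OF sums])
  qed
qed

section \<open>Random sums of Dirac measures\<close>

text \<open>
The sum of Dirac measures as the image of a weighted counting measure; integrals over it then become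
series. Indices whose point falls outside \<open>E\<close> contribute nothing to either side.
\<close>

lemma dirac_sum_eq_distr:
  fixes E :: "'a::euclidean_space set"
  shows "dirac_sum E w x =
    distr (density (count_space {k. x k \<in> E}) (\<lambda>k. of_nat (w k))) (borel_on E) x"
    (is "_ = ?D")
proof -
  have meas: "x \<in> measurable (density (count_space {k. x k \<in> E}) (\<lambda>k. of_nat (w k))) (borel_on E)"
    by (auto simp: space_restrict_space)
  have D: "emeasure ?D B = (\<Sum>k. of_nat (w k) * emeasure (return (borel_on E) (x k)) B)"
    if B: "B \<in> sets (borel_on E)" for B
  proof -
    have "B \<subseteq> E" using sets.sets_into_space[OF B] by (simp add: space_restrict_space)
    have "emeasure ?D B = (\<integral>\<^sup>+k. of_nat (w k) * indicator {k. x k \<in> B} k \<partial>count_space {k. x k \<in> E})"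
      unfolding emeasure_distr[OF meas B]
      by (subst emeasure_density) (auto intro!: nn_integral_cong simp: indicator_def)
    also have "\<dots> = (\<Sum>k. of_nat (w k) * indicator {k. x k \<in> B} k * indicator {k. x k \<in> E} k)"
      by (subst nn_integral_count_space_indicator) (auto simp: nn_integral_count_space_nat)
    also have "\<dots> = (\<Sum>k. of_nat (w k) * emeasure (return (borel_on E) (x k)) B)"
      using \<open>B \<subseteq> E\<close> by (intro suminf_cong) (auto simp: indicator_def B)
    finally show ?thesis .
  qed
  have "dirac_sum E w x = measure_of (space ?D) (sets ?D) (emeasure ?D)"
    unfolding dirac_sum_def
  proof (simp add: space_restrict_space, rule measure_of_eq)
    show "sets (borel_on E) \<subseteq> Pow E"
      using sets.space_closed[of "borel_on E"] by (simp add: space_restrict_space)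
    fix B assume "B \<in> sigma_sets E (sets (borel_on E))"
    then have "B \<in> sets (borel_on E)"
      using sets.sigma_sets_eq[of "borel_on E"] by (simp add: space_restrict_space)
    then show "(\<Sum>k. of_nat (w k) * emeasure (return (borel_on E) (x k)) B) = emeasure ?D B"
      by (rule D[symmetric])
  qed
  then show ?thesis unfolding measure_of_of_measure .
qed

lemma sets_dirac_sum: "sets (dirac_sum E w x) = sets (borel_on E)"
  by (simp add: dirac_sum_eq_distr)

lemma space_dirac_sum: "space (dirac_sum E w x) = E"
  by (simp add: dirac_sum_eq_distr space_restrict_space)

lemma nn_integral_dirac_sum:
  assumes "f \<in> borel_measurable (borel_on E)"
  shows "(\<integral>\<^sup>+y. f y \<partial>dirac_sum E w x) = (\<Sum>k. of_nat (w k) * (f (x k) * indicator E (x k)))"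
proof -
  have "(\<integral>\<^sup>+y. f y \<partial>dirac_sum E w x) = (\<integral>\<^sup>+k. of_nat (w k) * f (x k) \<partial>count_space {k. x k \<in> E})"
    unfolding dirac_sum_eq_distr
    by (subst nn_integral_distr) (auto simp: assms space_restrict_space nn_integral_density)
  also have "\<dots> = (\<Sum>k. of_nat (w k) * f (x k) * indicator {k. x k \<in> E} k)"
    by (subst nn_integral_count_space_indicator) (auto simp: nn_integral_count_space_nat)
  also have "\<dots> = (\<Sum>k. of_nat (w k) * (f (x k) * indicator E (x k)))"
    by (intro suminf_cong) (auto simp: indicator_def)
  finally show ?thesis .
qed

lemma emeasure_dirac_sum:
  assumes B: "B \<in> sets (borel_on E)"
  shows "emeasure (dirac_sum E w x) B = (\<Sum>k. of_nat (w k) * indicator B (x k))"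
proof -
  have "B \<subseteq> E" using sets.sets_into_space[OF B] by (simp add: space_restrict_space)
  have "emeasure (dirac_sum E w x) B = (\<integral>\<^sup>+y. indicator B y \<partial>dirac_sum E w x)"
    using B by (simp add: sets_dirac_sum)
  also have "\<dots> = (\<Sum>k. of_nat (w k) * (indicator B (x k) * indicator E (x k)))"
    using B by (intro nn_integral_dirac_sum) auto
  also have "\<dots> = (\<Sum>k. of_nat (w k) * indicator B (x k))"
    using \<open>B \<subseteq> E\<close> by (intro suminf_cong) (auto simp: indicator_def)
  finally show ?thesis .
qed

text \<open>
Every relatively compact subset of a carrier lies in an annulus, so local finiteness is a countable, and
therefore measurable, condition.
\<close>

definition annulus :: "nat \<Rightarrow> 'a::real_normed_vector set" where
  "annulus m = {x. 1 / (1 + real m) \<le> norm x \<and> norm x \<le> 1 + real m}"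

lemma annulus_borel [measurable]: "annulus m \<in> sets (borel :: 'a::euclidean_space measure)"
  unfolding annulus_def by measurable

lemma annulus_sets_borel_on: "E \<inter> annulus m \<in> sets (borel_on E)" for E :: "'a::euclidean_space set"
  unfolding sets_restrict_space by (auto intro: annulus_borel)

lemma locally_finite_measures_iff:
  fixes \<mu> :: "'a::euclidean_space measure"
  assumes sets: "sets \<mu> = sets (borel_on E)"
  shows "\<mu> \<in> locally_finite_measures E \<longleftrightarrow> (\<forall>m. emeasure \<mu> (E \<inter> annulus m) < \<infinity>)"
proof
  have "relatively_compact_in E (E \<inter> annulus m)" for m
    unfolding relatively_compact_in_def bounded_iff
  proof (intro conjI)
    show "\<exists>R. \<forall>x\<in>E \<inter> annulus m. norm x \<le> R" unfolding annulus_def by blast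
    show "\<exists>\<delta>>0. \<forall>x\<in>E \<inter> annulus m. \<delta> \<le> norm x"
      by (intro exI[of _ "1 / (1 + real m)"]) (auto simp: annulus_def)
  qed auto
  then show "\<forall>m. emeasure \<mu> (E \<inter> annulus m) < \<infinity>" if "\<mu> \<in> locally_finite_measures E"
    using that annulus_sets_borel_on unfolding locally_finite_measures_def by blast
next
  assume fin: "\<forall>m. emeasure \<mu> (E \<inter> annulus m) < \<infinity>"
  have "emeasure \<mu> B < \<infinity>" if B: "relatively_compact_in E B" for B
  proof -
    obtain \<delta> R where \<delta>: "0 < \<delta>" "\<And>x. x \<in> B \<Longrightarrow> \<delta> \<le> norm x \<and> norm x \<le> R" "B \<subseteq> E"
      using B unfolding relatively_compact_in_def bounded_iff by blast
    obtain m :: nat where m: "max R (1 / \<delta>) \<le> real m" using real_arch_simple by blast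
    have "1 / (1 + real m) \<le> \<delta>" using m \<delta>(1) by (auto simp: field_simps)
    then have "B \<subseteq> E \<inter> annulus m" using \<delta> m unfolding annulus_def by fastforce
    then have "emeasure \<mu> B \<le> emeasure \<mu> (E \<inter> annulus m)"
      using annulus_sets_borel_on sets by (intro emeasure_mono) auto
    then show ?thesis using fin by (meson le_less_trans)
  qed
  then show "\<mu> \<in> locally_finite_measures E"
    using sets unfolding locally_finite_measures_def by auto
qed

lemma dirac_sum_locally_finite_iff:
  fixes E :: "'a::euclidean_space set"
  shows "dirac_sum E w x \<in> locally_finite_measures E \<longleftrightarrow>
    (\<forall>m. (\<Sum>k. of_nat (w k) * indicator (E \<inter> annulus m) (x k) :: ennreal) < \<infinity>)"
  by (simp add: locally_finite_measures_iff[OF sets_dirac_sum] emeasure_dirac_sum annulus_sets_borel_on)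

text \<open>
Every bounded set contains only finitely many of the points with positive weight, since they satisfy
\<open>\<parallel>(z k / a) v k\<parallel> \<ge> \<epsilon> * z k / a\<close>, which tends to infinity.
\<close>

lemma scaled_sequence_locally_finite:
  fixes v :: "nat \<Rightarrow> 'a::euclidean_space"
  assumes z_lim: "filterlim z at_top sequentially" and zp: "\<And>k. 0 < z k" and a: "0 < a"
    and \<epsilon>: "0 < \<epsilon>" and v: "\<And>k. w k \<noteq> 0 \<Longrightarrow> \<epsilon> \<le> norm (v k)"
  shows "dirac_sum punctured_space w (\<lambda>k. (z k / a) *\<^sub>R v k) \<in> locally_finite_measures punctured_space"
  unfolding dirac_sum_locally_finite_iff
proof
  fix m
  let ?t = "\<lambda>k. of_nat (w k) * indicator (punctured_space \<inter> annulus m) ((z k / a) *\<^sub>R v k) :: ennreal"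
  obtain K where K: "\<And>k. k \<ge> K \<Longrightarrow> (1 + real m) * a / \<epsilon> < z k"
    using filterlim_at_top_dense[THEN iffD1, OF z_lim] unfolding eventually_sequentially by blast
  have "?t k = 0" if "k \<notin> {..<K}" for k
  proof (cases "w k = 0")
    case False
    then have "z k * \<epsilon> \<le> z k * norm (v k)"
      using v zp[of k] by (intro mult_left_mono) auto
    moreover have "(1 + real m) * a < z k * \<epsilon>"
      using K[of k] that \<epsilon> by (simp add: pos_divide_less_eq)
    ultimately have "(1 + real m) * a < z k * norm (v k)" by linarith
    then have "1 + real m < norm ((z k / a) *\<^sub>R v k)"
      using zp[of k] a by (simp add: pos_less_divide_eq)
    then show ?thesis by (simp add: annulus_def)
  qed simp
  then have "(\<Sum>k. ?t k) = (\<Sum>k<K. ?t k)" by (intro suminf_finite) auto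
  also have "\<dots> < \<infinity>"
    by (simp add: ennreal_mult_less_top indicator_def of_nat_less_top)
  finally show "(\<Sum>k. ?t k) < \<infinity>" .
qed

text \<open>
If \<open>t k * v k\<close> lies in an annulus, then \<open>t k\<close> lies in a fixed compact interval of \<open>(0, \<infinity>)\<close>,
so the number of points in the annulus is at most the number of the \<open>t k\<close> in that interval.
\<close>

lemma scaled_points_locally_finite:
  fixes v :: "nat \<Rightarrow> 'a::euclidean_space"
  assumes lf: "dirac_sum {0<..} (\<lambda>_. 1) t \<in> locally_finite_measures {0<..}" and t: "\<And>k. 0 < t k"
    and \<epsilon>: "0 < \<epsilon>" and r: "0 < r" and v: "\<And>k. \<epsilon> \<le> norm (v k) \<and> norm (v k) \<le> r"
  shows "dirac_sum punctured_space (\<lambda>_. 1) (\<lambda>k. t k *\<^sub>R v k) \<in> locally_finite_measures punctured_space"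
  unfolding dirac_sum_locally_finite_iff
proof
  fix m
  let ?I = "{1 / (1 + real m) / r .. (1 + real m) / \<epsilon>}"
  have I: "?I \<subseteq> {0<..}" using r by (auto intro: less_le_trans[of 0 "1 / (1 + real m) / r"])
  have I_sets: "?I \<in> sets (borel_on {0<..})"
    using I by (simp add: sets_restrict_space_iff)
  have rc: "relatively_compact_in {0<..} ?I"
    using I r unfolding relatively_compact_in_def
    by (auto intro!: exI[of _ "1 / (1 + real m) / r"])
  have "of_nat 1 * indicator (punctured_space \<inter> annulus m) (t k *\<^sub>R v k) \<le>
      (of_nat 1 * indicator ?I (t k) :: ennreal)" for k
  proof (cases "t k *\<^sub>R v k \<in> annulus m")
    case True
    have "0 < t k" by (rule t)
    then have "t k * norm (v k) \<le> t k * r" "t k * \<epsilon> \<le> t k * norm (v k)"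
      using v by (auto intro!: mult_left_mono)
    moreover have "1 / (1 + real m) \<le> t k * norm (v k)" "t k * norm (v k) \<le> 1 + real m"
      using True \<open>0 < t k\<close> by (auto simp: annulus_def)
    ultimately have "1 / (1 + real m) \<le> t k * r" "t k * \<epsilon> \<le> 1 + real m" by linarith+
    then have "t k \<in> ?I"
      unfolding atLeastAtMost_iff pos_divide_le_eq[OF r] pos_le_divide_eq[OF \<epsilon>] by blast
    then show ?thesis by (simp add: indicator_def)
  qed simp
  then have "(\<Sum>k. of_nat 1 * indicator (punctured_space \<inter> annulus m) (t k *\<^sub>R v k) :: ennreal) \<le>
      (\<Sum>k. of_nat 1 * indicator ?I (t k))"
    by (intro suminf_le) auto
  also have "\<dots> = emeasure (dirac_sum {0<..} (\<lambda>_. 1) t) ?I"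
    by (rule emeasure_dirac_sum[OF I_sets, symmetric])
  also have "\<dots> < \<infinity>"
    using lf I_sets rc unfolding locally_finite_measures_def by blast
  finally show "(\<Sum>k. of_nat 1 * indicator (punctured_space \<inter> annulus m) (t k *\<^sub>R v k) :: ennreal) < \<infinity>" .
qed

lemma dirac_sum_integral_sums:
  assumes lf: "dirac_sum E w x \<in> locally_finite_measures E" and f: "f \<in> vague_test_functions E"
    and x: "\<And>k. x k \<in> E"
  shows "(\<lambda>k. real (w k) * f (x k)) sums (\<integral>y. f y \<partial>dirac_sum E w x)"
proof -
  let ?\<mu> = "dirac_sum E w x"
  have nonneg: "0 \<le> f y" if "y \<in> E" for y
    using f that by (simp add: vague_test_functions_def)
  have meas: "f \<in> borel_measurable (borel_on E)"
    by (rule vague_test_function_measurable[OF f])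
  have "ennreal (\<integral>y. f y \<partial>?\<mu>) = (\<integral>\<^sup>+y. ennreal (f y) \<partial>?\<mu>)"
    by (rule nn_integral_eq_integral[symmetric, OF vague_test_function_integrable[OF f lf]])
      (auto simp: space_dirac_sum nonneg)
  also have "\<dots> = (\<Sum>k. of_nat (w k) * (ennreal (f (x k)) * indicator E (x k)))"
    using meas by (intro nn_integral_dirac_sum) auto
  also have "\<dots> = (\<Sum>k. ennreal (real (w k) * f (x k)))"
    using x by (intro suminf_cong) (auto simp: ennreal_mult nonneg ennreal_of_nat_eq_real_of_nat)
  finally have "(\<lambda>k. ennreal (real (w k) * f (x k))) sums ennreal (\<integral>y. f y \<partial>?\<mu>)"
    by (simp add: summable_sums)
  then show ?thesis
    using x by (subst (asm) sums_ennreal)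
      (auto simp: nonneg vague_integral_nonneg[OF f lf])
qed

text \<open>
An uncountable union of subbasic events need not be measurable; that preimages of arbitrary vaguely open
sets are events comes from the countable family inducing the topology, which reduces them to
preimages of open sets under a single Borel map into the space of real sequences.
\<close>

lemma random_element_dirac_sum:
  fixes E :: "'a::euclidean_space set"
  assumes E: "E \<in> sets borel"
    and w [measurable]: "\<And>k. w k \<in> measurable M (count_space UNIV)"
    and x [measurable]: "\<And>k. x k \<in> borel_measurable M"
    and lf: "AE \<omega> in M. dirac_sum E (\<lambda>k. w k \<omega>) (\<lambda>k. x k \<omega>) \<in> locally_finite_measures E"
  shows "random_element M (vague_topology E) (\<lambda>\<omega>. dirac_sum E (\<lambda>k. w k \<omega>) (\<lambda>k. x k \<omega>))"
proof -
  let ?\<xi> = "\<lambda>\<omega>. dirac_sum E (\<lambda>k. w k \<omega>) (\<lambda>k. x k \<omega>)"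
  have nn: "(\<lambda>\<omega>. \<integral>\<^sup>+y. f y \<partial>?\<xi> \<omega>) \<in> borel_measurable M"
    if f: "f \<in> borel_measurable (borel_on E)" for f :: "'a \<Rightarrow> ennreal"
  proof -
    have [measurable]: "(\<lambda>y. f y * indicator E y) \<in> borel_measurable borel"
      using f E by (subst (asm) borel_measurable_restrict_space_iff_ennreal) auto
    show ?thesis unfolding nn_integral_dirac_sum[OF f] by measurable
  qed
  have int [measurable]: "(\<lambda>\<omega>. \<integral>y. f y \<partial>?\<xi> \<omega>) \<in> borel_measurable M" if f: "f \<in> vague_test_functions E" for f
  proof -
    have meas: "f \<in> borel_measurable (borel_on E)"
      by (rule vague_test_function_measurable[OF f])
    have "(\<integral>y. f y \<partial>?\<xi> \<omega>) = enn2real (\<integral>\<^sup>+y. ennreal (f y) \<partial>?\<xi> \<omega>)" for \<omega>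
    proof (rule integral_eq_nn_integral)
      show "f \<in> borel_measurable (?\<xi> \<omega>)"
        using meas measurable_cong_sets[OF sets_dirac_sum refl] by blast
      show "AE y in ?\<xi> \<omega>. 0 \<le> f y"
        using f by (auto simp: space_dirac_sum vague_test_functions_def)
    qed
    moreover have "(\<lambda>\<omega>. \<integral>\<^sup>+y. ennreal (f y) \<partial>?\<xi> \<omega>) \<in> borel_measurable M"
      using meas by (intro nn) auto
    ultimately show ?thesis by simp
  qed
  have LF: "{\<omega> \<in> space M. ?\<xi> \<omega> \<in> locally_finite_measures E} \<in> sets M"
    using E unfolding dirac_sum_locally_finite_iff by measurable
  obtain g :: "nat \<Rightarrow> 'a \<Rightarrow> real" where g: "\<And>j. g j \<in> vague_test_functions E"
    and initial: "\<And>U. openin (vague_topology E) U \<Longrightarrow>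
      \<exists>W. open W \<and> U = {\<mu> \<in> topspace (vague_topology E). (\<lambda>j. exp (- (\<integral>x. g j x \<partial>\<mu>))) \<in> W}"
    by (rule vague_topology_countably_generated[of E]) blast
  have "{\<omega> \<in> space M. ?\<xi> \<omega> \<in> U} \<in> sets M" if U: "openin (vague_topology E) U" for U
  proof -
    obtain W where W: "open W" "U = {\<mu> \<in> topspace (vague_topology E). (\<lambda>j. exp (- (\<integral>x. g j x \<partial>\<mu>))) \<in> W}"
      using initial[OF U] by blast
    have "(\<lambda>\<omega> j. exp (- (\<integral>x. g j x \<partial>?\<xi> \<omega>))) \<in> borel_measurable M"
      using int[OF g] by (intro measurable_coordinatewise_then_product) simp
    from measurable_sets[OF this, of W] W(1)
    have "{\<omega> \<in> space M. (\<lambda>j. exp (- (\<integral>x. g j x \<partial>?\<xi> \<omega>))) \<in> W} \<in> sets M"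
      by (simp add: vimage_def Int_def conj_commute)
    from sets.Int[OF LF this] show ?thesis
      unfolding W(2) topspace_vague_topology by (simp add: Int_def conj_ac cong: conj_cong)
  qed
  then show ?thesis
    using lf unfolding random_element_def topspace_vague_topology by blast
qed

text \<open>
Laplace functionals of sums of Dirac measures as limits of expectations of finite products, the form in
which independence can be used. The factors are given separately as \<open>y k\<close>, since a test function is
unconstrained, and possibly not measurable, off its carrier.
\<close>

lemma tendsto_laplace_dirac_sum:
  assumes M: "prob_space M" and re: "random_element M (vague_topology E) \<xi>"
    and \<xi>: "AE \<omega> in M. \<xi> \<omega> = dirac_sum E (\<lambda>k. w k \<omega>) (\<lambda>k. x k \<omega>)"
    and x: "AE \<omega> in M. \<forall>k. x k \<omega> \<in> E"
    and f: "f \<in> vague_test_functions E"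
    and y: "\<And>k. y k \<in> borel_measurable M"
      "AE \<omega> in M. \<forall>k. y k \<omega> = exp (- (real (w k \<omega>) * f (x k \<omega>)))"
  shows "(\<lambda>m. \<integral>\<omega>. (\<Prod>k<m. y k \<omega>) \<partial>M) \<longlonglongrightarrow>
    expectation_of M (vague_topology E) (\<lambda>\<mu>. exp (- (\<integral>x. f x \<partial>\<mu>))) \<xi>"
  unfolding expectation_of_def set_lebesgue_integral_def
proof (rule integral_dominated_convergence[where w = "\<lambda>_. 1"])
  let ?A = "{\<omega> \<in> space M. \<xi> \<omega> \<in> topspace (vague_topology E)}"
  show "integrable M (\<lambda>_. 1 :: real)"
    using prob_space.finite_measure[OF M] by (simp add: finite_measure.integrable_const)
  have "continuous_map (vague_topology E) euclideanreal (\<lambda>\<mu>. exp (- (\<integral>x. f x \<partial>\<mu>)))"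
    by (rule continuous_map_laplace[OF f])
  then show "(\<lambda>\<omega>. indicator ?A \<omega> *\<^sub>R exp (- (\<integral>x. f x \<partial>\<xi> \<omega>))) \<in> borel_measurable M"
    by (rule random_element_borel_measurable[OF re])
  show "(\<lambda>\<omega>. \<Prod>k<m. y k \<omega>) \<in> borel_measurable M" for m
    using y(1) by (intro borel_measurable_prod) auto
  have "AE \<omega> in M. \<xi> \<omega> \<in> locally_finite_measures E"
    using re unfolding random_element_def topspace_vague_topology by blast
  then show "AE \<omega> in M. (\<lambda>m. \<Prod>k<m. y k \<omega>) \<longlonglongrightarrow> indicator ?A \<omega> *\<^sub>R exp (- (\<integral>x. f x \<partial>\<xi> \<omega>))"
    using \<xi> x y(2) AE_space
  proof eventually_elim
    case (elim \<omega>)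
    have "(\<lambda>k. real (w k \<omega>) * f (x k \<omega>)) sums (\<integral>x. f x \<partial>\<xi> \<omega>)"
      using elim dirac_sum_integral_sums[OF _ f] by auto
    then have "(\<lambda>m. exp (- (\<Sum>k<m. real (w k \<omega>) * f (x k \<omega>)))) \<longlonglongrightarrow> exp (- (\<integral>x. f x \<partial>\<xi> \<omega>))"
      unfolding sums_def by (intro tendsto_intros)
    then show ?case
      using elim by (simp add: topspace_vague_topology exp_sum sum_negf[symmetric])
  qed
  show "AE \<omega> in M. norm (\<Prod>k<m. y k \<omega>) \<le> 1" for m
    using x y(2)
  proof eventually_elim
    case (elim \<omega>)
    have "0 \<le> real (w k \<omega>) * f (x k \<omega>)" for k
      using elim f by (auto simp: vague_test_functions_def)
    then have "(\<Prod>k<m. y k \<omega>) \<le> 1" "0 \<le> (\<Prod>k<m. y k \<omega>)"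
      using elim by (auto intro!: prod_le_1 prod_nonneg)
    then show ?case by simp
  qed
qed

section \<open>Averaging over the marks\<close>

definition mark_laplace :: "'a::euclidean_space measure \<Rightarrow> ('a \<Rightarrow> real) \<Rightarrow> real \<Rightarrow> real" where
  "mark_laplace L f t = (\<integral>v. exp (- f (t *\<^sub>R v)) \<partial>L)"

lemma scaled_test_function_continuous:
  fixes f :: "'a::euclidean_space \<Rightarrow> real"
  assumes f: "f \<in> vague_test_functions punctured_space" and t: "0 < t"
  shows "continuous_on punctured_space (\<lambda>v. f (t *\<^sub>R v))"
proof (rule continuous_on_compose2[of punctured_space f])
  show "continuous_on punctured_space f" using f by (simp add: vague_test_functions_def)
  show "continuous_on punctured_space (\<lambda>v :: 'a. t *\<^sub>R v)" by (intro continuous_intros)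
qed (use t in auto)

text \<open>
Continuity is dominated convergence, and \<open>exp (- sup f) \<le> mark_laplace L f t \<le> 1\<close> bounds the
logarithm. If \<open>f\<close> is supported in \<open>\<delta> \<le> \<parallel>x\<parallel> \<le> R\<close>, then \<open>f (t v) = 0\<close> for almost all
\<open>v\<close> unless \<open>\<delta> / r \<le> t \<le> R / \<epsilon>\<close>, which gives the compact support.
\<close>

lemma mark_laplace_test_function:
  fixes f :: "'a::euclidean_space \<Rightarrow> real"
  assumes L: "prob_space L" "sets L = sets (borel_on punctured_space)"
    and \<epsilon>: "0 < \<epsilon>" "0 < r" and bounds: "AE v in L. \<epsilon> \<le> norm v \<and> norm v \<le> r"
    and f: "f \<in> vague_test_functions punctured_space"
  shows mark_laplace_pos: "\<And>t. 0 < t \<Longrightarrow> 0 < mark_laplace L f t"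
    and mark_laplace_le_1: "\<And>t. 0 < t \<Longrightarrow> mark_laplace L f t \<le> 1"
    and ln_mark_laplace_test_function: "(\<lambda>t. - ln (mark_laplace L f t)) \<in> vague_test_functions {0<..}"
proof -
  interpret prob_space L by fact
  have spL: "space L = punctured_space"
    using sets_eq_imp_space_eq[OF L(2)] by (simp add: space_restrict_space)
  have nz: "AE v in L. v \<noteq> 0" using AE_space by eventually_elim (simp add: spL)
  obtain B where B: "0 < B" "\<And>x. x \<in> punctured_space \<Longrightarrow> \<bar>f x\<bar> \<le> B"
    using vague_test_function_bounded[OF f] by blast
  have f0: "0 \<le> f x" if "x \<noteq> 0" for x using f that by (simp add: vague_test_functions_def)
  obtain \<delta> R where \<delta>: "0 < \<delta>"
    and R: "\<And>x. x \<in> punctured_space \<Longrightarrow> f x \<noteq> 0 \<Longrightarrow> \<delta> \<le> norm x \<and> norm x \<le> R"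
    using vague_test_function_support[OF f] by blast
  have meas: "(\<lambda>v. exp (- f (t *\<^sub>R v))) \<in> borel_measurable L" if "0 < t" for t
  proof -
    have "continuous_on punctured_space (\<lambda>v. exp (- f (t *\<^sub>R v)))"
      by (intro continuous_intros scaled_test_function_continuous f that)
    then have "(\<lambda>v. exp (- f (t *\<^sub>R v))) \<in> borel_measurable (borel_on punctured_space)"
      by (rule borel_measurable_continuous_on_restrict)
    then show ?thesis using measurable_cong_sets[OF L(2) refl] by blast
  qed
  have int: "integrable L (\<lambda>v. exp (- f (t *\<^sub>R v)))" if "0 < t" for t
    by (rule integrable_const_bound[where B = 1, OF _ meas[OF that]])
      (use nz f0 that in \<open>auto elim!: eventually_mono\<close>)
  have le1: "mark_laplace L f t \<le> 1" if "0 < t" for t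
    unfolding mark_laplace_def
    by (rule integral_le_const[OF int[OF that]]) (use nz f0 that in \<open>auto elim!: eventually_mono\<close>)
  have geB: "exp (- B) \<le> mark_laplace L f t" if t: "0 < t" for t
    unfolding mark_laplace_def
  proof (rule integral_ge_const[OF int[OF that]])
    show "AE v in L. exp (- B) \<le> exp (- f (t *\<^sub>R v))"
      using nz
    proof eventually_elim
      case (elim v)
      then show ?case using B(2)[of "t *\<^sub>R v"] t by auto
    qed
  qed
  have pos: "0 < mark_laplace L f t" if "0 < t" for t
    using geB[OF that] by (rule less_le_trans[OF exp_gt_zero])
  show "0 < mark_laplace L f t" "mark_laplace L f t \<le> 1" if "0 < t" for t
    using pos le1 that by auto
  have "continuous_on {0<..} (mark_laplace L f)"
    unfolding continuous_on_sequentially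
  proof (intro allI ballI impI, elim conjE)
    fix x :: "nat \<Rightarrow> real" and a assume a: "a \<in> {0<..}" and x: "\<forall>n. x n \<in> {0<..}" "x \<longlonglongrightarrow> a"
    show "(mark_laplace L f \<circ> x) \<longlonglongrightarrow> mark_laplace L f a"
      unfolding mark_laplace_def o_def
    proof (rule integral_dominated_convergence[where w = "\<lambda>_. 1"])
      show "(\<lambda>v. exp (- f (a *\<^sub>R v))) \<in> borel_measurable L" using a by (intro meas) auto
      show "(\<lambda>v. exp (- f (x n *\<^sub>R v))) \<in> borel_measurable L" for n using x by (intro meas) auto
      show "AE v in L. (\<lambda>n. exp (- f (x n *\<^sub>R v))) \<longlonglongrightarrow> exp (- f (a *\<^sub>R v))"
        using nz
      proof eventually_elim
        case (elim v)
        have "(\<lambda>n. f (x n *\<^sub>R v)) \<longlonglongrightarrow> f (a *\<^sub>R v)"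
        proof (rule continuous_on_tendsto_compose[where s = punctured_space and f = f])
          show "continuous_on punctured_space f" using f by (simp add: vague_test_functions_def)
          show "(\<lambda>n. x n *\<^sub>R v) \<longlonglongrightarrow> a *\<^sub>R v" by (intro tendsto_intros x)
          show "a *\<^sub>R v \<in> punctured_space" using a elim by auto
          show "eventually (\<lambda>n. x n *\<^sub>R v \<in> punctured_space) sequentially"
            using x(1) elim by (intro always_eventually) (auto simp: less_imp_neq[symmetric])
        qed
        then show ?case by (intro tendsto_intros)
      qed
      show "AE v in L. norm (exp (- f (x n *\<^sub>R v))) \<le> 1" for n
        using nz
      proof eventually_elim
        case (elim v)
        have "x n > 0" using x(1) by auto
        then show ?case using f0[of "x n *\<^sub>R v"] elim by simp
      qed
    qed simp
  qed
  then have cont: "continuous_on {0<..} (\<lambda>t. - ln (mark_laplace L f t))"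
    using pos by (intro continuous_intros) (auto simp: less_imp_neq[symmetric])
  have nonneg: "0 \<le> - ln (mark_laplace L f t)" if "0 < t" for t
    using le1[OF that] pos[OF that] by simp
  have leB: "- ln (mark_laplace L f t) \<le> B" if "0 < t" for t
    using ln_mono[OF geB[OF that] exp_gt_zero] by simp
  have bdd: "bounded ((\<lambda>t. - ln (mark_laplace L f t)) ` {0<..})"
    unfolding bounded_iff
  proof (intro exI ballI)
    fix y assume "y \<in> (\<lambda>t. - ln (mark_laplace L f t)) ` {0<..}"
    then obtain t where "0 < t" "y = - ln (mark_laplace L f t)" by auto
    then show "norm y \<le> B" using nonneg[of t] leB[of t] by simp
  qed
  have supp: "\<delta> / r \<le> t \<and> t \<le> R / \<epsilon>" if t: "0 < t" and ne: "- ln (mark_laplace L f t) \<noteq> 0" for t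
  proof (rule ccontr)
    assume out: "\<not> (\<delta> / r \<le> t \<and> t \<le> R / \<epsilon>)"
    have "AE v in L. exp (- f (t *\<^sub>R v)) = 1"
      using nz bounds
    proof eventually_elim
      case (elim v)
      have "\<not> (\<delta> \<le> t * norm v \<and> t * norm v \<le> R)"
      proof
        assume A: "\<delta> \<le> t * norm v \<and> t * norm v \<le> R"
        have "t * norm v \<le> t * r" "t * \<epsilon> \<le> t * norm v"
          using elim t by (auto intro!: mult_left_mono)
        with A have "\<delta> \<le> t * r" "t * \<epsilon> \<le> R" by auto
        with out \<epsilon> show False by (auto simp: field_simps)
      qed
      then show ?case using R[of "t *\<^sub>R v"] t elim by auto
    qed
    then have "mark_laplace L f t = (\<integral>v. 1 \<partial>L)"
      unfolding mark_laplace_def using meas[OF t] by (intro integral_cong_AE) auto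
    then show False using ne by (simp add: prob_space)
  qed
  have "relatively_compact_in {0<..} {t \<in> {0<..}. - ln (mark_laplace L f t) \<noteq> 0}"
    unfolding relatively_compact_in_def bounded_iff
  proof (intro conjI)
    show "\<exists>a. \<forall>t\<in>{t \<in> {0<..}. - ln (mark_laplace L f t) \<noteq> 0}. norm t \<le> a"
      using supp by (intro exI[of _ "R / \<epsilon>"]) auto
    show "\<exists>d>0. \<forall>t\<in>{t \<in> {0<..}. - ln (mark_laplace L f t) \<noteq> 0}. d \<le> norm t"
      using supp \<delta> \<epsilon> by (intro exI[of _ "\<delta> / r"]) auto
  qed auto
  then show "(\<lambda>t. - ln (mark_laplace L f t)) \<in> vague_test_functions {0<..}"
    using cont bdd nonneg unfolding vague_test_functions_def by auto
qed

text \<open>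
Independence of the two sequences makes their joint law a product measure. By Fubini the marks may be
integrated out for frozen values of \<open>Z\<close>, and there their independence factorises the product.
\<close>

lemma expectation_prod_independent_marks:
  fixes h :: "'t \<Rightarrow> 's \<Rightarrow> real"
  assumes N: "prob_space N"
    and ind: "independent_pair N (\<Pi>\<^sub>M k\<in>UNIV. A) (\<lambda>\<omega> k. Z k \<omega>) (\<Pi>\<^sub>M k\<in>UNIV. S) (\<lambda>\<omega> k. V k \<omega>)"
    and iid: "prob_space.indep_vars N (\<lambda>_. S) V UNIV" "\<And>k :: nat. distr N S (V k) = L"
    and h: "(\<lambda>(t, v). h t v) \<in> borel_measurable (A \<Otimes>\<^sub>M S)"
    and h01: "\<And>t v. 0 \<le> h t v" "\<And>t v. h t v \<le> 1"
  shows "(\<integral>\<omega>. (\<Prod>k<m. h (Z k \<omega>) (V k \<omega>)) \<partial>N) = (\<integral>\<omega>. (\<Prod>k<m. \<integral>v. h (Z k \<omega>) v \<partial>L) \<partial>N)"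
proof -
  interpret N: prob_space N by fact
  let ?MA = "\<Pi>\<^sub>M k\<in>(UNIV :: nat set). A" and ?MS = "\<Pi>\<^sub>M k\<in>(UNIV :: nat set). S"
  let ?Z = "\<lambda>\<omega> k. Z k \<omega>" and ?V = "\<lambda>\<omega> k. V k \<omega>"
  have Z [measurable]: "?Z \<in> measurable N ?MA" and V [measurable]: "?V \<in> measurable N ?MS"
    using ind unfolding independent_pair_def by auto
  have Vk [measurable]: "V k \<in> measurable N S" for k
    using iid(1) unfolding N.indep_vars_def2 by auto
  have setsL [measurable_cong]: "sets L = sets S" using iid(2)[of 0] by auto
  interpret L: prob_space L using N.prob_space_distr[OF Vk[of 0]] iid(2)[of 0] by simp
  define PA where "PA = distr N ?MA ?Z"
  define PS where "PS = distr N ?MS ?V"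
  have [measurable_cong]: "sets PA = sets ?MA" "sets PS = sets ?MS" by (simp_all add: PA_def PS_def)
  interpret PA: prob_space PA unfolding PA_def by (rule N.prob_space_distr[OF Z])
  interpret PS: prob_space PS unfolding PS_def by (rule N.prob_space_distr[OF V])
  interpret P: pair_prob_space PA PS ..
  have joint: "PA \<Otimes>\<^sub>M PS = distr N (?MA \<Otimes>\<^sub>M ?MS) (\<lambda>\<omega>. (?Z \<omega>, ?V \<omega>))"
  proof (rule pair_measure_eqI)
    show "sigma_finite_measure PA" "sigma_finite_measure PS" by unfold_locales
    show "sets (PA \<Otimes>\<^sub>M PS) = sets (distr N (?MA \<Otimes>\<^sub>M ?MS) (\<lambda>\<omega>. (?Z \<omega>, ?V \<omega>)))"
      by (simp add: PA_def PS_def cong: sets_pair_measure_cong)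
    fix C D assume "C \<in> sets PA" "D \<in> sets PS"
    then have C: "C \<in> sets ?MA" and D: "D \<in> sets ?MS" by (simp_all add: PA_def PS_def)
    have "emeasure PA C * emeasure PS D =
        ennreal (N.prob (?Z -` C \<inter> space N) * N.prob (?V -` D \<inter> space N))"
      using C D by (simp add: PA_def PS_def emeasure_distr N.emeasure_eq_measure ennreal_mult)
    also have "N.prob (?Z -` C \<inter> space N) * N.prob (?V -` D \<inter> space N) =
        N.prob ((?Z -` C \<inter> space N) \<inter> (?V -` D \<inter> space N))"
      by (rule N.indep_setD[symmetric]) (use ind C D in \<open>auto simp: independent_pair_def\<close>)
    also have "(?Z -` C \<inter> space N) \<inter> (?V -` D \<inter> space N) =
        (\<lambda>\<omega>. (?Z \<omega>, ?V \<omega>)) -` (C \<times> D) \<inter> space N" by auto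
    also have "ennreal (N.prob \<dots>) = emeasure (distr N (?MA \<Otimes>\<^sub>M ?MS) (\<lambda>\<omega>. (?Z \<omega>, ?V \<omega>))) (C \<times> D)"
      using C D by (subst emeasure_distr) (auto simp: N.emeasure_eq_measure)
    finally show "emeasure PA C * emeasure PS D =
        emeasure (distr N (?MA \<Otimes>\<^sub>M ?MS) (\<lambda>\<omega>. (?Z \<omega>, ?V \<omega>))) (C \<times> D)" .
  qed
  define H where "H = (\<lambda>(z, v). \<Prod>k<m. h (z k) (v k))"
  have H: "H \<in> borel_measurable (?MA \<Otimes>\<^sub>M ?MS)"
  proof -
    have "(\<lambda>p. (\<lambda>(t, v). h t v) (fst p k, snd p k)) \<in> borel_measurable (?MA \<Otimes>\<^sub>M ?MS)" for k
      by (rule measurable_compose[OF _ h]) measurable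
    then show ?thesis
      unfolding H_def split_beta by (intro borel_measurable_prod) simp
  qed
  have H01: "norm (H p) \<le> 1" for p
    unfolding H_def split_beta using h01 by (auto intro!: prod_le_1 simp: prod_nonneg abs_prod)
  have H_int: "integrable (PA \<Otimes>\<^sub>M PS) H"
    using H H01 by (intro P.integrable_const_bound[where B = 1]) (auto cong: measurable_cong_sets)
  have h_sec: "h t \<in> borel_measurable S" if "t \<in> space A" for t
    using measurable_Pair2[OF h that] by simp
  have inner: "(\<integral>v. H (z, v) \<partial>PS) = (\<Prod>k<m. \<integral>v. h (z k) v \<partial>L)" if z: "z \<in> space ?MA" for z
  proof -
    have zk: "z k \<in> space A" for k using z by (auto simp: space_PiM)
    have Hz: "(\<lambda>v. H (z, v)) \<in> borel_measurable ?MS" using measurable_Pair2[OF H z] by simp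
    have "(\<integral>v. H (z, v) \<partial>PS) = (\<integral>\<omega>. (\<Prod>k<m. h (z k) (V k \<omega>)) \<partial>N)"
      unfolding PS_def by (subst integral_distr[OF V Hz]) (simp add: H_def)
    also have "\<dots> = (\<Prod>k<m. \<integral>\<omega>. h (z k) (V k \<omega>) \<partial>N)"
    proof (rule N.indep_vars_lebesgue_integral)
      show "N.indep_vars (\<lambda>_. borel) (\<lambda>k \<omega>. h (z k) (V k \<omega>)) {..<m}"
        using N.indep_vars_compose2[OF N.indep_vars_subset[OF iid(1)], of "{..<m}" "\<lambda>k. h (z k)" "\<lambda>_. borel"]
          h_sec[OF zk] by auto
      show "integrable N (\<lambda>\<omega>. h (z k) (V k \<omega>))" for k
        using h01 measurable_compose[OF Vk h_sec[OF zk]]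
        by (intro N.integrable_const_bound[where B = 1]) auto
    qed simp
    also have "\<dots> = (\<Prod>k<m. \<integral>v. h (z k) v \<partial>L)"
      using integral_distr[OF Vk h_sec[OF zk], unfolded iid(2)] by (intro prod.cong refl) simp
    finally show ?thesis .
  qed
  have h_L: "(\<lambda>t. \<integral>v. h t v \<partial>L) \<in> borel_measurable A"
    using h by (intro L.borel_measurable_lebesgue_integral) (auto cong: measurable_cong_sets sets_pair_measure_cong simp: setsL)
  have G: "(\<lambda>z. \<Prod>k<m. \<integral>v. h (z k) v \<partial>L) \<in> borel_measurable ?MA"
    by (intro borel_measurable_prod measurable_compose[OF _ h_L]) measurable
  have "(\<integral>\<omega>. (\<Prod>k<m. h (Z k \<omega>) (V k \<omega>)) \<partial>N) = (\<integral>p. H p \<partial>(PA \<Otimes>\<^sub>M PS))"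
    unfolding joint using H by (subst integral_distr) (auto simp: H_def)
  also have "\<dots> = (\<integral>z. \<integral>v. H (z, v) \<partial>PS \<partial>PA)"
    by (rule P.integral_fst'[OF H_int, symmetric])
  also have "\<dots> = (\<integral>z. (\<Prod>k<m. \<integral>v. h (z k) v \<partial>L) \<partial>PA)"
    by (intro Bochner_Integration.integral_cong inner) (auto simp: PA_def)
  also have "\<dots> = (\<integral>\<omega>. (\<Prod>k<m. \<integral>v. h (Z k \<omega>) v \<partial>L) \<partial>N)"
    unfolding PA_def using G by (subst integral_distr[OF Z]) auto
  finally show ?thesis .
qed

lemma AE_conditional_law:
  assumes M: "prob_space M"
    and X [measurable]: "X \<in> measurable M (count_space UNIV)" and V: "V \<in> measurable M S"
    and cond: "measure M {\<omega> \<in> space M. X \<omega> = x} > 0 \<Longrightarrow>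
      distr (uniform_measure M {\<omega> \<in> space M. X \<omega> = x}) S V = L"
    and P: "AE v in L. P v"
  shows "AE \<omega> in M. X \<omega> = x \<longrightarrow> P (V \<omega>)"
proof (cases "measure M {\<omega> \<in> space M. X \<omega> = x} > 0")
  case True
  interpret prob_space M by fact
  let ?A = "{\<omega> \<in> space M. X \<omega> = x}"
  have "AE v in distr (uniform_measure M ?A) S V. P v"
    unfolding cond[OF True] by (rule P)
  then have "AE \<omega> in uniform_measure M ?A. P (V \<omega>)"
  proof (rule AE_distrD[rotated])
    show "V \<in> measurable (uniform_measure M ?A) S"
      using V measurable_cong_sets[OF sets_uniform_measure refl] by blast
  qed
  then have "AE \<omega> in M. \<omega> \<in> ?A \<longrightarrow> P (V \<omega>)"
    using True by (subst (asm) AE_uniform_measure) (auto simp: emeasure_eq_measure)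
  then show ?thesis using AE_space by eventually_elim auto
next
  case False
  interpret prob_space M by fact
  have "prob {\<omega> \<in> space M. X \<omega> = x} = 0"
    using False measure_nonneg[of M "{\<omega> \<in> space M. X \<omega> = x}"] by linarith
  then have "AE \<omega> in M. \<omega> \<notin> {\<omega> \<in> space M. X \<omega> = x}"
    by (subst (asm) prob_eq_0) auto
  then show ?thesis using AE_space by eventually_elim auto
qed

text \<open>
Replacing the mark by its average over \<open>L\<close> changes nothing on \<open>X = 0\<close>, where both integrands
are \<open>1\<close>, nor in the mean on \<open>X = 1\<close>, where the mark has conditional law \<open>L\<close>. Otherwise the integrands
lie in the unit interval.
\<close>

lemma replace_mark_error:
  fixes X :: "'w \<Rightarrow> nat" and h :: "'s \<Rightarrow> real"
  assumes M: "prob_space M"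
    and X [measurable]: "X \<in> measurable M (count_space UNIV)" and V [measurable]: "V \<in> measurable M S"
    and L: "prob_space L"
    and cond: "measure M {\<omega> \<in> space M. X \<omega> = 1} > 0 \<Longrightarrow>
      distr (uniform_measure M {\<omega> \<in> space M. X \<omega> = 1}) S V = L"
    and h [measurable]: "h \<in> borel_measurable S" and h0: "\<And>v. 0 \<le> h v"
    and \<phi>: "\<phi> = (\<integral>v. exp (- h v) \<partial>L)" "0 \<le> \<phi>" "\<phi> \<le> 1"
  shows "\<bar>(\<integral>\<omega>. exp (- (real (X \<omega>) * h (V \<omega>))) \<partial>M) - (\<integral>\<omega>. \<phi> ^ X \<omega> \<partial>M)\<bar> \<le> measure M {\<omega> \<in> space M. 2 \<le> X \<omega>}"
proof -
  interpret prob_space M by fact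
  let ?A = "{\<omega> \<in> space M. X \<omega> = 1}" and ?C = "{\<omega> \<in> space M. 2 \<le> X \<omega>}"
  define D where "D \<omega> = exp (- (real (X \<omega>) * h (V \<omega>))) - \<phi> ^ X \<omega>" for \<omega>
  have bd: "0 \<le> exp (- (real (X \<omega>) * h (V \<omega>)))" "exp (- (real (X \<omega>) * h (V \<omega>))) \<le> 1"
    "0 \<le> \<phi> ^ X \<omega>" "\<phi> ^ X \<omega> \<le> 1" for \<omega>
    using h0 \<phi> by (auto intro: power_le_one)
  have D_meas [measurable]: "D \<in> borel_measurable M" unfolding D_def by measurable
  have D1: "\<bar>D \<omega>\<bar> \<le> 1" for \<omega> using bd[of \<omega>] unfolding D_def by linarith
  have int1: "integrable M (\<lambda>\<omega>. exp (- (real (X \<omega>) * h (V \<omega>))))" "integrable M (\<lambda>\<omega>. \<phi> ^ X \<omega>)"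
    using bd \<phi> by (auto intro!: integrable_const_bound[where B = 1] simp: power_abs abs_of_nonneg)
  have int2: "integrable M (\<lambda>\<omega>. indicator ?A \<omega> * D \<omega>)" "integrable M (\<lambda>\<omega>. indicator ?C \<omega> * D \<omega>)"
    using D1 by (auto intro!: integrable_const_bound[where B = 1] simp: indicator_def)
  have int3: "integrable M (\<lambda>\<omega>. indicator ?A \<omega> * exp (- h (V \<omega>)))"
    using h0 by (auto intro!: integrable_const_bound[where B = 1] simp: indicator_def)
  have int4: "integrable M (\<lambda>\<omega>. indicator ?A \<omega> * \<phi>)"
    using \<phi> by (auto intro!: integrable_const_bound[where B = 1] simp: indicator_def)
  have single: "(\<integral>\<omega>. indicator ?A \<omega> * exp (- h (V \<omega>)) \<partial>M) = prob ?A * \<phi>"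
  proof (cases "prob ?A > 0")
    case True
    have "\<phi> = (\<integral>\<omega>. exp (- h (V \<omega>)) \<partial>uniform_measure M ?A)"
      unfolding \<phi> cond[OF True, symmetric] by (subst integral_distr) auto
    also have "uniform_measure M ?A = density M (\<lambda>\<omega>. ennreal (indicator ?A \<omega> / prob ?A))"
      unfolding uniform_measure_def using True
      by (intro density_cong) (auto simp: emeasure_eq_measure divide_ennreal[symmetric] ennreal_indicator)
    also have "(\<integral>\<omega>. exp (- h (V \<omega>)) \<partial>density M (\<lambda>\<omega>. ennreal (indicator ?A \<omega> / prob ?A))) =
        (\<integral>\<omega>. (indicator ?A \<omega> / prob ?A) *\<^sub>R exp (- h (V \<omega>)) \<partial>M)"
      by (intro integral_density) auto
    also have "\<dots> = (\<integral>\<omega>. indicator ?A \<omega> * exp (- h (V \<omega>)) \<partial>M) / prob ?A"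
      by (simp add: field_simps)
    finally show ?thesis using True by simp
  next
    case False
    then have "prob ?A = 0" using measure_nonneg[of M ?A] by linarith
    then have "AE \<omega> in M. \<omega> \<notin> ?A" by (subst (asm) prob_eq_0) auto
    then have "(\<integral>\<omega>. indicator ?A \<omega> * exp (- h (V \<omega>)) \<partial>M) = (\<integral>\<omega>. 0 \<partial>M)"
      by (intro integral_cong_AE) (auto elim!: eventually_mono simp: indicator_def)
    then show ?thesis using \<open>prob ?A = 0\<close> by simp
  qed
  have "(\<integral>\<omega>. indicator ?A \<omega> * D \<omega> \<partial>M) = (\<integral>\<omega>. indicator ?A \<omega> * exp (- h (V \<omega>)) - indicator ?A \<omega> * \<phi> \<partial>M)"
    by (intro Bochner_Integration.integral_cong) (auto simp: D_def indicator_def)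
  also have "\<dots> = 0"
    using single by (subst Bochner_Integration.integral_diff[OF int3 int4]) (simp add: Int_absorb2)
  finally have zero: "(\<integral>\<omega>. indicator ?A \<omega> * D \<omega> \<partial>M) = 0" .
  have "(\<integral>\<omega>. exp (- (real (X \<omega>) * h (V \<omega>))) \<partial>M) - (\<integral>\<omega>. \<phi> ^ X \<omega> \<partial>M) = (\<integral>\<omega>. D \<omega> \<partial>M)"
    unfolding D_def by (rule Bochner_Integration.integral_diff[OF int1, symmetric])
  also have "\<dots> = (\<integral>\<omega>. indicator ?A \<omega> * D \<omega> + indicator ?C \<omega> * D \<omega> \<partial>M)"
  proof (intro Bochner_Integration.integral_cong refl)
    fix \<omega> assume "\<omega> \<in> space M"
    then show "D \<omega> = indicator ?A \<omega> * D \<omega> + indicator ?C \<omega> * D \<omega>"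
      by (cases "X \<omega> = 0"; cases "X \<omega> = 1") (auto simp: D_def indicator_def)
  qed
  also have "\<dots> = (\<integral>\<omega>. indicator ?C \<omega> * D \<omega> \<partial>M)"
    unfolding Bochner_Integration.integral_add[OF int2] zero by simp
  also have "\<bar>\<dots>\<bar> \<le> (\<integral>\<omega>. indicator ?C \<omega> \<partial>M)"
  proof (rule order_trans[OF integral_abs_bound], rule integral_mono)
    show "integrable M (indicator ?C :: _ \<Rightarrow> real)" by (intro integrable_real_indicator) (auto simp: emeasure_eq_measure)
    show "\<bar>indicator ?C \<omega> * D \<omega>\<bar> \<le> indicator ?C \<omega>" for \<omega>
      using D1 by (simp add: indicator_def)
  qed (intro integrable_abs int2)
  also have "\<dots> = prob ?C" by (simp add: Int_absorb2)
  finally show ?thesis .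
qed

text \<open>
The partial products decrease to \<open>P\<close> and are at most the exponential of minus the partial sums,
as \<open>1 - x \<le> exp (- x)\<close>.
\<close>

lemma summable_of_has_prod_one_minus:
  fixes p :: "nat \<Rightarrow> real"
  assumes p: "\<And>k. 0 \<le> p k" "\<And>k. p k \<le> 1" and P: "(\<lambda>k. 1 - p k) has_prod P" "0 < P"
  shows "summable p"
proof (rule summableI_nonneg_bounded[where x = "- ln P"])
  have lim: "(\<lambda>n. \<Prod>i\<le>n. 1 - p i) \<longlonglongrightarrow> P"
    using P unfolding has_prod_def raw_has_prod_def by auto
  have "decseq (\<lambda>n. \<Prod>i\<le>n. 1 - p i)"
    using p by (intro decseq_SucI) (auto intro!: mult_left_le prod_nonneg)
  then have ge: "P \<le> (\<Prod>i\<le>n. 1 - p i)" for n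
    using lim by (rule decseq_ge)
  show "sum p {..<n} \<le> - ln P" for n
  proof -
    have "P \<le> (\<Prod>i\<le>n. 1 - p i)" by (rule ge)
    also have "\<dots> \<le> (\<Prod>i\<le>n. exp (- p i))"
      using p exp_ge_add_one_self[of "- p i" for i] by (intro prod_mono) auto
    also have "\<dots> = exp (- (\<Sum>i\<le>n. p i))" by (simp add: exp_sum sum_negf[symmetric])
    finally have "ln P \<le> - (\<Sum>i\<le>n. p i)" using P(2) by (subst (asm) ln_le_cancel_iff[symmetric]) auto
    moreover have "sum p {..<n} \<le> (\<Sum>i\<le>n. p i)" using p by (intro sum_mono2) auto
    ultimately show ?thesis by simp
  qed
qed (rule p)

section \<open>Convergence of the marked processes\<close>

theorem theorem4p7:
  fixes z :: "nat \<Rightarrow> real"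
    and M :: "'w measure" and X :: "nat \<Rightarrow> 'w \<Rightarrow> nat"
    and V :: "nat \<Rightarrow> 'w \<Rightarrow> 'a::euclidean_space"
    and law_V :: "nat \<Rightarrow> 'a measure"
    and N :: "'v measure" and \<eta> :: "'v \<Rightarrow> real measure"
    and Z :: "nat \<Rightarrow> 'v \<Rightarrow> real" and V' :: "nat \<Rightarrow> 'v \<Rightarrow> 'a"
    and c \<epsilon> r :: real
  assumes z_pos: "\<And>k. 0 < z k" and z_mono: "incseq z"
    and z_lim: "filterlim z at_top sequentially"
    and M: "prob_space M"
    and X_indep: "prob_space.indep_vars M (\<lambda>_. count_space UNIV) X UNIV"
    and X_simple: "\<exists>p>0. (\<lambda>k. measure M {\<omega> \<in> space M. X k \<omega> = 0}
                          + measure M {\<omega> \<in> space M. X k \<omega> = 1}) has_prod p"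
    and c: "0 < c"
    and N: "prob_space N"
    and \<eta>: "poisson_process N {0<..} (log_intensity c) \<eta>"
    and conv: "vaguely_converges_in_distribution {0<..}
                 M (\<lambda>n \<omega>. dirac_sum {0<..} (\<lambda>k. X k \<omega>) (\<lambda>k. z k / z n)) N \<eta>"
    and VX_indep: "prob_space.indep_vars M
                     (\<lambda>_. borel_on punctured_space \<Otimes>\<^sub>M count_space UNIV)
                     (\<lambda>k \<omega>. (V k \<omega>, X k \<omega>)) UNIV"
    and law_V: "\<And>x. prob_space (law_V x)"
      "\<And>x. sets (law_V x) = sets (borel_on punctured_space)"
    and V_cond: "\<And>k x. measure M {\<omega> \<in> space M. X k \<omega> = x} > 0 \<Longrightarrow>
      distr (uniform_measure M {\<omega> \<in> space M. X k \<omega> = x}) (borel_on punctured_space) (V k) = law_V x"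
    and \<epsilon>_r: "0 < \<epsilon>" "\<epsilon> < r"
    and V_bounds: "\<And>x. 1 \<le> x \<Longrightarrow> AE v in law_V x. \<epsilon> \<le> norm v \<and> norm v \<le> r"
    and Z_enum: "\<And>k. Z k \<in> borel_measurable N" "AE \<omega> in N. \<forall>k. 0 < Z k \<omega>"
      "AE \<omega> in N. \<eta> \<omega> = dirac_sum {0<..} (\<lambda>_. 1) (\<lambda>k. Z k \<omega>)"
    and V'_iid: "prob_space.indep_vars N (\<lambda>_. borel_on punctured_space) V' UNIV"
      "\<And>k. distr N (borel_on punctured_space) (V' k) = law_V 1"
    and V'_indep_Z: "independent_pair N
      (\<Pi>\<^sub>M k\<in>UNIV. borel) (\<lambda>\<omega> k. Z k \<omega>)
      (\<Pi>\<^sub>M k\<in>UNIV. borel_on punctured_space) (\<lambda>\<omega> k. V' k \<omega>)"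
  shows "vaguely_converges_in_distribution punctured_space
           M (\<lambda>n \<omega>. dirac_sum punctured_space (\<lambda>k. X k \<omega>) (\<lambda>k. (z k / z n) *\<^sub>R V k \<omega>))
           N (\<lambda>\<omega>. dirac_sum punctured_space (\<lambda>_. 1) (\<lambda>k. Z k \<omega> *\<^sub>R V' k \<omega>))"
proof -
  interpret M: prob_space M by (rule M)
  interpret N: prob_space N by (rule N)
  let ?E = "punctured_space :: 'a set"
  let ?vague = "vague_topology ?E"
  let ?\<nu> = "\<lambda>n \<omega>. dirac_sum {0<..} (\<lambda>k. X k \<omega>) (\<lambda>k. z k / z n)"
  let ?\<nu>V = "\<lambda>n \<omega>. dirac_sum ?E (\<lambda>k. X k \<omega>) (\<lambda>k. (z k / z n) *\<^sub>R V k \<omega>)"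
  let ?\<eta>V = "\<lambda>\<omega>. dirac_sum ?E (\<lambda>_. 1) (\<lambda>k. Z k \<omega> *\<^sub>R V' k \<omega>)"
  have E_borel: "?E \<in> sets borel" by auto
  have id_E [measurable]: "(\<lambda>v :: 'a. v) \<in> measurable (borel_on ?E) borel"
    by (rule measurable_restrict_space1) simp
  have VX: "(\<lambda>\<omega>. (V k \<omega>, X k \<omega>)) \<in> measurable M (borel_on ?E \<Otimes>\<^sub>M count_space UNIV)" for k
    using VX_indep unfolding M.indep_vars_def2 by auto
  have V_meas: "V k \<in> measurable M (borel_on ?E)" for k
    using measurable_compose[OF VX measurable_fst] by simp
  have X_meas [measurable]: "X k \<in> measurable M (count_space UNIV)" for k
    using measurable_compose[OF VX measurable_snd] by simp
  have V_borel [measurable]: "V k \<in> borel_measurable M" for k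
    using measurable_compose[OF V_meas id_E] by simp
  have V'_meas: "V' k \<in> measurable N (borel_on ?E)" for k
    using V'_iid(1) unfolding N.indep_vars_def2 by auto
  have V'_borel [measurable]: "V' k \<in> borel_measurable N" for k
    using measurable_compose[OF V'_meas id_E] by simp
  have Z_meas [measurable]: "Z k \<in> borel_measurable N" for k by (rule Z_enum)
  have r: "0 < r" using \<epsilon>_r by simp
  have zz: "0 < z k / z n" for k n using z_pos by simp
  have V_nz: "V k \<omega> \<noteq> 0" if "\<omega> \<in> space M" for k \<omega>
    using measurable_space[OF V_meas that] by (simp add: space_restrict_space)
  have V'_nz: "V' k \<omega> \<noteq> 0" if "\<omega> \<in> space N" for k \<omega>
    using measurable_space[OF V'_meas that] by (simp add: space_restrict_space)
  have V_bd: "AE \<omega> in M. \<forall>k. 1 \<le> X k \<omega> \<longrightarrow> \<epsilon> \<le> norm (V k \<omega>) \<and> norm (V k \<omega>) \<le> r"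
  proof -
    have "AE \<omega> in M. X k \<omega> = x \<longrightarrow> 1 \<le> x \<longrightarrow> \<epsilon> \<le> norm (V k \<omega>) \<and> norm (V k \<omega>) \<le> r" for k x
    proof (cases "1 \<le> x")
      case True
      have "AE \<omega> in M. X k \<omega> = x \<longrightarrow> \<epsilon> \<le> norm (V k \<omega>) \<and> norm (V k \<omega>) \<le> r"
        by (rule AE_conditional_law[OF M X_meas V_meas V_cond V_bounds[OF True]])
      then show ?thesis by eventually_elim blast
    qed simp
    then have "AE \<omega> in M. \<forall>k x. X k \<omega> = x \<longrightarrow> 1 \<le> x \<longrightarrow> \<epsilon> \<le> norm (V k \<omega>) \<and> norm (V k \<omega>) \<le> r"
      unfolding AE_all_countable by blast
    then show ?thesis by eventually_elim blast
  qed
  have V'_bd: "AE \<omega> in N. \<forall>k. \<epsilon> \<le> norm (V' k \<omega>) \<and> norm (V' k \<omega>) \<le> r"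
  proof -
    have "AE v in distr N (borel_on ?E) (V' k). \<epsilon> \<le> norm v \<and> norm v \<le> r" for k
      unfolding V'_iid(2) by (rule V_bounds) simp
    then have "AE \<omega> in N. \<epsilon> \<le> norm (V' k \<omega>) \<and> norm (V' k \<omega>) \<le> r" for k
      by (intro AE_distrD[OF V'_meas])
    then show ?thesis unfolding AE_all_countable by blast
  qed
  have re: "random_element M ?vague (?\<nu>V n)" for n
  proof (rule random_element_dirac_sum[OF E_borel])
    show "AE \<omega> in M. ?\<nu>V n \<omega> \<in> locally_finite_measures ?E"
      using V_bd
    proof eventually_elim
      case (elim \<omega>)
      then show ?case
        by (intro scaled_sequence_locally_finite[OF z_lim z_pos z_pos[of n] \<epsilon>_r(1)]) auto
    qed
  qed measurable
  have re': "random_element N ?vague ?\<eta>V"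
  proof (rule random_element_dirac_sum[OF E_borel])
    have "AE \<omega> in N. \<eta> \<omega> \<in> locally_finite_measures {0<..}"
      using \<eta> unfolding poisson_process_def by (intro AE_I2) auto
    with Z_enum(2,3) V'_bd AE_space
    show "AE \<omega> in N. ?\<eta>V \<omega> \<in> locally_finite_measures ?E"
    proof eventually_elim
      case (elim \<omega>)
      then show ?case
        by (intro scaled_points_locally_finite[OF _ _ \<epsilon>_r(1) r]) auto
    qed
  qed measurable
  define p where "p k = M.prob {\<omega> \<in> space M. 2 \<le> X k \<omega>}" for k
  have p_eq: "M.prob {\<omega> \<in> space M. X k \<omega> = 0} + M.prob {\<omega> \<in> space M. X k \<omega> = 1} = 1 - p k" for k
  proof -
    have "M.prob {\<omega> \<in> space M. X k \<omega> = 0} + M.prob {\<omega> \<in> space M. X k \<omega> = 1} =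
        M.prob ({\<omega> \<in> space M. X k \<omega> = 0} \<union> {\<omega> \<in> space M. X k \<omega> = 1})"
      by (rule M.finite_measure_Union[symmetric]) auto
    also have "{\<omega> \<in> space M. X k \<omega> = 0} \<union> {\<omega> \<in> space M. X k \<omega> = 1} = space M - {\<omega> \<in> space M. 2 \<le> X k \<omega>}"
      by auto
    also have "M.prob \<dots> = 1 - p k" unfolding p_def by (rule M.prob_compl) measurable
    finally show ?thesis .
  qed
  have p: "0 \<le> p k" "p k \<le> 1" for k by (simp_all add: p_def)
  have p_summable: "summable p"
    using X_simple unfolding p_eq by (auto intro: summable_of_has_prod_one_minus[OF p])
  show ?thesis
  proof (rule laplace_convergence_imp_vague_convergence[OF M N re re'])
    fix f0 assume f0: "f0 \<in> vague_test_functions ?E"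
    \<comment> \<open>The value of a test function at the origin is arbitrary; setting it to \<open>0\<close> makes \<open>f\<close>
      Borel measurable and nonnegative on the whole space.\<close>
    define f where "f x = (if x = 0 then 0 else f0 x)" for x
    have f_eq: "f x = f0 x" if "x \<in> ?E" for x using that by (simp add: f_def)
    have f: "f \<in> vague_test_functions ?E"
    proof (rule vague_test_functions_dominated[OF f0, of _ 1])
      show "continuous_on ?E f"
        by (rule continuous_on_eq[of ?E f0]) (use f0 f_eq in \<open>auto simp: vague_test_functions_def\<close>)
      show "0 \<le> f x" "f x \<le> 1 * f0 x" if "x \<in> ?E" for x
        using f0 that by (auto simp: f_eq[OF that] vague_test_functions_def)
    qed
    have f_nonneg: "0 \<le> f x" for x
      using f0 by (auto simp: f_def vague_test_functions_def)
    have f_borel [measurable]: "f \<in> borel_measurable borel"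
    proof -
      have "(\<lambda>x. indicator ?E x *\<^sub>R f x) \<in> borel_measurable borel"
        using vague_test_function_measurable[OF f] by (subst (asm) borel_measurable_restrict_space_iff) auto
      also have "(\<lambda>x. indicator ?E x *\<^sub>R f x) = f" by (auto simp: f_def indicator_def)
      finally show ?thesis .
    qed
    have expectation_f: "expectation_of Q ?vague (\<lambda>\<mu>. exp (- (\<integral>x. f0 x \<partial>\<mu>))) \<xi> =
        expectation_of Q ?vague (\<lambda>\<mu>. exp (- (\<integral>x. f x \<partial>\<mu>))) \<xi>" for Q :: "'q measure" and \<xi>
    proof (rule expectation_of_cong)
      fix \<mu> assume "\<mu> \<in> topspace ?vague"
      then have "(\<integral>x. f0 x \<partial>\<mu>) = (\<integral>x. f x \<partial>\<mu>)"
        using space_locally_finite[of \<mu> ?E] f_eq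
        by (intro Bochner_Integration.integral_cong) (auto simp: topspace_vague_topology)
      then show "exp (- (\<integral>x. f0 x \<partial>\<mu>)) = exp (- (\<integral>x. f x \<partial>\<mu>))" by simp
    qed
    define \<phi> where "\<phi> = mark_laplace (law_V 1) f"
    define g where "g t = - ln (\<phi> t)" for t
    have L1: "AE v in law_V 1. \<epsilon> \<le> norm v \<and> norm v \<le> r" by (rule V_bounds) simp
    note mark = mark_laplace_test_function[OF law_V(1) law_V(2) \<epsilon>_r(1) r L1 f, folded \<phi>_def, folded g_def]
    have g: "g \<in> vague_test_functions {0<..}" by (rule mark(3))
    have exp_g: "exp (- (real n * g t)) = \<phi> t ^ n" if "0 < t" for n t
      using mark(1)[OF that] by (simp add: g_def exp_of_nat_mult)
    let ?eta = "expectation_of N (vague_topology {0<..}) (\<lambda>\<mu>. exp (- (\<integral>x. g x \<partial>\<mu>))) \<eta>"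
    have conv_re: "random_element M (vague_topology {0<..}) (?\<nu> n)"
      and conv_re': "random_element N (vague_topology {0<..}) \<eta>" for n
      using conv unfolding converges_in_distribution_def by auto
    \<comment> \<open>Both sides are limits of one and the same sequence of expectations of finite products.\<close>
    have limit: "expectation_of N ?vague (\<lambda>\<mu>. exp (- (\<integral>x. f x \<partial>\<mu>))) ?\<eta>V = ?eta"
    proof (rule LIMSEQ_unique)
      let ?h = "\<lambda>t v. exp (- f (t *\<^sub>R v))"
      have h_meas: "(\<lambda>(t, v). ?h t v) \<in> borel_measurable (borel \<Otimes>\<^sub>M borel_on ?E)"
      proof -
        have [measurable]: "snd \<in> borel_measurable (borel \<Otimes>\<^sub>M borel_on ?E)"
          using measurable_compose[OF measurable_snd id_E] by simp
        show ?thesis unfolding split_beta by measurable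
      qed
      show "(\<lambda>m. \<integral>\<omega>. (\<Prod>k<m. ?h (Z k \<omega>) (V' k \<omega>)) \<partial>N) \<longlonglongrightarrow>
          expectation_of N ?vague (\<lambda>\<mu>. exp (- (\<integral>x. f x \<partial>\<mu>))) ?\<eta>V"
      proof (rule tendsto_laplace_dirac_sum[OF N re' _ _ f])
        show "AE \<omega> in N. \<forall>k. Z k \<omega> *\<^sub>R V' k \<omega> \<in> ?E"
          using Z_enum(2) AE_space
        proof eventually_elim
          case (elim \<omega>)
          show ?case
          proof
            fix k
            have "0 < Z k \<omega>" using elim by auto
            then show "Z k \<omega> *\<^sub>R V' k \<omega> \<in> ?E" using V'_nz[OF elim(2)] by simp
          qed
        qed
        show "(\<lambda>\<omega>. ?h (Z k \<omega>) (V' k \<omega>)) \<in> borel_measurable N" for k by measurable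
      qed auto
      have "(\<integral>\<omega>. (\<Prod>k<m. ?h (Z k \<omega>) (V' k \<omega>)) \<partial>N) = (\<integral>\<omega>. (\<Prod>k<m. \<integral>v. ?h (Z k \<omega>) v \<partial>law_V 1) \<partial>N)" for m
        by (rule expectation_prod_independent_marks[OF N V'_indep_Z V'_iid h_meas])
          (auto simp: f_nonneg)
      then have eq: "(\<lambda>m. \<integral>\<omega>. (\<Prod>k<m. ?h (Z k \<omega>) (V' k \<omega>)) \<partial>N) = (\<lambda>m. \<integral>\<omega>. (\<Prod>k<m. \<phi> (Z k \<omega>)) \<partial>N)"
        by (simp add: \<phi>_def mark_laplace_def)
      interpret L: prob_space "law_V 1" by (rule law_V)
      have \<phi>_meas: "\<phi> \<in> borel_measurable borel"
        unfolding \<phi>_def mark_laplace_def [abs_def]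
        using h_meas
        by (intro L.borel_measurable_lebesgue_integral) (auto cong: measurable_cong_sets sets_pair_measure_cong simp: law_V(2))
      show "(\<lambda>m. \<integral>\<omega>. (\<Prod>k<m. ?h (Z k \<omega>) (V' k \<omega>)) \<partial>N) \<longlonglongrightarrow> ?eta"
        unfolding eq
      proof (rule tendsto_laplace_dirac_sum[OF N conv_re' Z_enum(3) _ g])
        show "AE \<omega> in N. \<forall>k. Z k \<omega> \<in> {0<..}" using Z_enum(2) by simp
        show "(\<lambda>\<omega>. \<phi> (Z k \<omega>)) \<in> borel_measurable N" for k
          using measurable_compose[OF Z_meas \<phi>_meas] .
        show "AE \<omega> in N. \<forall>k. \<phi> (Z k \<omega>) = exp (- (real 1 * g (Z k \<omega>)))"
          using Z_enum(2) by eventually_elim (simp only: exp_g power_one_right simp_thms)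
      qed
    qed
    let ?A = "\<lambda>n. expectation_of M ?vague (\<lambda>\<mu>. exp (- (\<integral>x. f x \<partial>\<mu>))) (?\<nu>V n)"
    let ?B = "\<lambda>n. expectation_of M (vague_topology {0<..}) (\<lambda>\<mu>. exp (- (\<integral>x. g x \<partial>\<mu>))) (?\<nu> n)"
    define a where "a n k = (\<integral>\<omega>. exp (- (real (X k \<omega>) * f ((z k / z n) *\<^sub>R V k \<omega>))) \<partial>M)" for n k
    define b where "b n k = (\<integral>\<omega>. \<phi> (z k / z n) ^ X k \<omega> \<partial>M)" for n k
    have f01: "0 \<le> exp (- (real x * f y))" "exp (- (real x * f y)) \<le> 1" for x y
      using f_nonneg by auto
    have \<phi>01: "0 \<le> \<phi> (z k / z n) ^ x" "\<phi> (z k / z n) ^ x \<le> 1" for x k n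
      using mark(1,2)[OF zz[of k n]] by (auto intro: power_le_one)
    have lim_a: "(\<lambda>m. \<Prod>k<m. a n k) \<longlonglongrightarrow> ?A n" for n
    proof -
      let ?y = "\<lambda>k \<omega>. exp (- (real (X k \<omega>) * f ((z k / z n) *\<^sub>R V k \<omega>)))"
      have h_meas: "(\<lambda>p. exp (- (real (snd p) * f (t *\<^sub>R fst p)))) \<in>
          borel_measurable (borel_on ?E \<Otimes>\<^sub>M count_space UNIV)" for t
      proof -
        have [measurable]: "fst \<in> borel_measurable (borel_on ?E \<Otimes>\<^sub>M (count_space UNIV :: nat measure))"
          using measurable_compose[OF measurable_fst id_E] by simp
        show ?thesis by measurable
      qed
      have ind: "M.indep_vars (\<lambda>_. borel) ?y UNIV"
        using M.indep_vars_compose2[OF VX_indep, of "\<lambda>k p. exp (- (real (snd p) * f ((z k / z n) *\<^sub>R fst p)))" "\<lambda>_. borel"]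
          h_meas by simp
      have "(\<Prod>k<m. a n k) = (\<integral>\<omega>. (\<Prod>k<m. ?y k \<omega>) \<partial>M)" for m
        unfolding a_def
        by (rule M.indep_vars_lebesgue_integral[symmetric])
          (auto intro!: M.indep_vars_subset[OF ind] M.integrable_const_bound[where B = 1] simp: f01 f_nonneg)
      moreover have "(\<lambda>m. \<integral>\<omega>. (\<Prod>k<m. ?y k \<omega>) \<partial>M) \<longlonglongrightarrow> ?A n"
      proof (rule tendsto_laplace_dirac_sum[OF M re _ _ f])
        show "AE \<omega> in M. \<forall>k. (z k / z n) *\<^sub>R V k \<omega> \<in> ?E"
          using AE_space
        proof eventually_elim
          case (elim \<omega>)
          show ?case using V_nz[OF elim] z_pos by (simp add: less_imp_neq[symmetric])
        qed
      qed auto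
      ultimately show ?thesis by simp
    qed
    have lim_b: "(\<lambda>m. \<Prod>k<m. b n k) \<longlonglongrightarrow> ?B n" for n
    proof -
      let ?y = "\<lambda>k \<omega>. \<phi> (z k / z n) ^ X k \<omega>"
      have ind: "M.indep_vars (\<lambda>_. borel) ?y UNIV"
        using M.indep_vars_compose2[OF X_indep, of "\<lambda>k x. \<phi> (z k / z n) ^ x" "\<lambda>_. borel"] by simp
      have "(\<Prod>k<m. b n k) = (\<integral>\<omega>. (\<Prod>k<m. ?y k \<omega>) \<partial>M)" for m
        unfolding b_def
        by (rule M.indep_vars_lebesgue_integral[symmetric])
          (auto intro!: M.indep_vars_subset[OF ind] M.integrable_const_bound[where B = 1] simp: abs_of_nonneg \<phi>01 simp del: power_abs)
      moreover have "(\<lambda>m. \<integral>\<omega>. (\<Prod>k<m. ?y k \<omega>) \<partial>M) \<longlonglongrightarrow> ?B n"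
        by (rule tendsto_laplace_dirac_sum[OF M conv_re _ _ g])
          (use zz in \<open>auto simp: exp_g\<close>)
      ultimately show ?thesis by simp
    qed
    have ab01: "norm (a n k) \<le> 1" "norm (b n k) \<le> 1" for n k
    proof -
      have unit: "norm (\<integral>\<omega>. u \<omega> \<partial>M) \<le> 1"
        if [measurable]: "u \<in> borel_measurable M" and u: "\<And>\<omega>. 0 \<le> u \<omega>" "\<And>\<omega>. u \<omega> \<le> 1" for u :: "'w \<Rightarrow> real"
      proof -
        have "integrable M u" using u by (intro M.integrable_const_bound[where B = 1]) auto
        then have "(\<integral>\<omega>. u \<omega> \<partial>M) \<le> 1" using u by (intro M.integral_le_const) auto
        then show ?thesis using u by (simp add: Bochner_Integration.integral_nonneg)
      qed
      show "norm (a n k) \<le> 1" "norm (b n k) \<le> 1"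
        unfolding a_def b_def by (rule unit; (rule f01 \<phi>01)?; measurable)+
    qed
    have ab_le: "\<bar>a n k - b n k\<bar> \<le> p k" for n k
    proof -
      have "(\<lambda>v. f ((z k / z n) *\<^sub>R v)) \<in> borel_measurable (borel_on ?E)"
        by (rule measurable_compose[OF id_E]) measurable
      from replace_mark_error[OF M X_meas V_meas law_V(1) V_cond this f_nonneg]
      show ?thesis
        using mark(1,2)[OF zz[of k n]] unfolding a_def b_def p_def
        by (simp add: \<phi>_def mark_laplace_def)
    qed
    obtain \<delta> R where \<delta>: "0 < \<delta>"
      and R: "\<And>x. x \<in> ?E \<Longrightarrow> f x \<noteq> 0 \<Longrightarrow> \<delta> \<le> norm x \<and> norm x \<le> R"
      using vague_test_function_support[OF f] by blast
    \<comment> \<open>For such \<open>k\<close> the scaled mark does not reach the support of \<open>f\<close>, and both factors are \<open>1\<close>.\<close>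
    have ab_eq: "a n k = b n k" if small: "z k / z n * r < \<delta>" for n k
    proof -
      have f_small: "f ((z k / z n) *\<^sub>R v) = 0" if "norm v \<le> r" for v
      proof (rule ccontr)
        assume "f ((z k / z n) *\<^sub>R v) \<noteq> 0"
        moreover from this have "(z k / z n) *\<^sub>R v \<in> ?E" by (auto simp: f_def)
        ultimately have "\<delta> \<le> norm ((z k / z n) *\<^sub>R v)" using R by blast
        also have "\<dots> = z k / z n * norm v" using z_pos[of k] z_pos[of n] by simp
        also have "\<dots> \<le> z k / z n * r" using that zz[of k n] by (intro mult_left_mono) auto
        finally show False using small by simp
      qed
      have "a n k = (\<integral>\<omega>. 1 \<partial>M)"
        unfolding a_def
      proof (rule integral_cong_AE)
        show "AE \<omega> in M. exp (- (real (X k \<omega>) * f ((z k / z n) *\<^sub>R V k \<omega>))) = 1"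
          using V_bd
        proof eventually_elim
          case (elim \<omega>)
          then show ?case using f_small[of "V k \<omega>"] by (cases "X k \<omega> = 0") auto
        qed
      qed measurable
      moreover have "\<phi> (z k / z n) = (\<integral>v. 1 \<partial>law_V 1)"
        unfolding \<phi>_def mark_laplace_def
      proof (rule integral_cong_AE)
        show "AE v in law_V 1. exp (- f ((z k / z n) *\<^sub>R v)) = 1"
          using L1 by eventually_elim (simp add: f_small)
        show "(\<lambda>v. exp (- f ((z k / z n) *\<^sub>R v))) \<in> borel_measurable (law_V 1)"
          using measurable_compose[OF id_E, of "\<lambda>v. exp (- f ((z k / z n) *\<^sub>R v))" borel]
          unfolding measurable_cong_sets[OF law_V(2) refl] by simp
      qed simp
      ultimately show ?thesis
        using prob_space.prob_space[OF law_V(1)[of 1]] by (simp add: b_def M.prob_space)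
    qed
    have "(\<lambda>n. ?A n - ?B n) \<longlonglongrightarrow> 0"
    proof (rule LIMSEQ_I)
      fix e :: real assume e: "0 < e"
      obtain K where K: "(\<Sum>k. p (k + K)) < e"
        using suminf_exist_split[OF e p_summable] p by (auto simp: suminf_nonneg summable_ignore_initial_segment p_summable abs_of_nonneg)
      have "eventually (\<lambda>n. z K * r / \<delta> < z n) sequentially"
        using filterlim_at_top_dense[THEN iffD1, OF z_lim] by blast
      then obtain n0 where n0: "\<And>n. n \<ge> n0 \<Longrightarrow> z K * r / \<delta> < z n"
        unfolding eventually_sequentially by blast
      have "norm (?A n - ?B n - 0) < e" if n: "n \<ge> n0" for n
      proof -
        \<comment> \<open>From \<open>n0\<close> on, the first \<open>K\<close> factors agree by \<open>ab_eq\<close>, and the others contribute at most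
          the tail of the series.\<close>
        have early: "a n k = b n k" if "k < K" for k
        proof (rule ab_eq)
          have "z k * r \<le> z K * r"
            using incseqD[OF z_mono, of k K] that r by (intro mult_right_mono) auto
          also have "\<dots> < \<delta> * z n" using n0[OF n] \<delta> by (simp add: pos_divide_less_eq mult.commute)
          finally show "z k / z n * r < \<delta>" using z_pos[of n] by (simp add: pos_divide_less_eq)
        qed
        have "\<bar>(\<Prod>k<m. a n k) - (\<Prod>k<m. b n k)\<bar> \<le> (\<Sum>k. p (k + K))" for m
        proof -
          have "\<bar>(\<Prod>k<m. a n k) - (\<Prod>k<m. b n k)\<bar> \<le> (\<Sum>k<m. \<bar>a n k - b n k\<bar>)"
            using norm_prod_diff[of "{..<m}" "a n" "b n"] ab01 by simp
          also have "\<dots> = (\<Sum>k\<in>{K..<m}. \<bar>a n k - b n k\<bar>)"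
            using early by (intro sum.mono_neutral_right) auto
          also have "\<dots> \<le> (\<Sum>k\<in>{K..<m}. p k)" by (intro sum_mono ab_le)
          also have "\<dots> = (\<Sum>k<m - K. p (k + K))"
            using sum.atLeastLessThan_shift_0[of p K m] by (simp add: atLeast0LessThan add.commute)
          also have "\<dots> \<le> (\<Sum>k. p (k + K))"
            using p p_summable by (intro sum_le_suminf) (auto simp: summable_ignore_initial_segment)
          finally show ?thesis .
        qed
        then have "\<bar>?A n - ?B n\<bar> \<le> (\<Sum>k. p (k + K))"
          by (intro LIMSEQ_le_const2[OF tendsto_rabs[OF tendsto_diff[OF lim_a lim_b]]]) auto
        then show ?thesis using K by simp
      qed
      then show "\<exists>n0. \<forall>n\<ge>n0. norm (?A n - ?B n - 0) < e" by blast
    qed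
    moreover have "?B \<longlonglongrightarrow> ?eta"
    proof -
      have "continuous_map (vague_topology {0<..}) euclideanreal (\<lambda>\<mu>. exp (- (\<integral>x. g x \<partial>\<mu>)))"
        by (rule continuous_map_laplace[OF g])
      moreover have "bounded ((\<lambda>\<mu>. exp (- (\<integral>x. g x \<partial>\<mu>))) ` topspace (vague_topology {0<..}))"
        using vague_integral_nonneg[OF g] unfolding bounded_iff topspace_vague_topology
        by (intro exI[of _ 1]) auto
      ultimately show ?thesis using conv unfolding converges_in_distribution_def by blast
    qed
    ultimately have "?A \<longlonglongrightarrow> ?eta"
      using tendsto_add[of "\<lambda>n. ?A n - ?B n" 0 sequentially ?B ?eta] by simp
    then show "(\<lambda>n. expectation_of M ?vague (\<lambda>\<mu>. exp (- (\<integral>x. f0 x \<partial>\<mu>))) (?\<nu>V n)) \<longlonglongrightarrow>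
        expectation_of N ?vague (\<lambda>\<mu>. exp (- (\<integral>x. f0 x \<partial>\<mu>))) ?\<eta>V"
      unfolding expectation_f limit .
  qed
qed

end
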